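(* Let $X$ be a Tychonoff space, let $\mathcal{U}_X$ be the universal uniformity of $X$, and let $\mathbb{R}_{>0}^X$ be the set of all functions from $X$ to $(0,\infty)$. The family \[ \mathcal{B}=\left\{ \sum_{n\in\mathbb{N}} V_{n} + \sum_{n\in\mathbb{N}} \frac{1}{\phi_n} X : \{V_{n}\}_{n\in\mathbb{N}}\in \mathcal{U}_X^{\mathbb{N}},\ \{\phi_n\}_{n\in\mathbb{N}}\in (\mathbb{R}^X_{>0})^{\mathbb{N}}\right\} \] forms a neighbourhood base at zero of the free topological vector space $\mathbb{V}(X)$, and the family \[ \mathcal{B}_L=\{ \mathrm{conv}(W): W\in\mathcal{B}\}, \] where $\mathrm{conv}(W)$ is the convex hull of $W$, is a base at zero of the free locally convex space $L(X)$.
   Context: Vector spaces are real; Tychonoff means completely regular and Hausdorff; $\mathbb{N}=\{1,2,\dots\}$. The free topological vector space $\mathbb{V}(X)$ (respectively, free locally convex space $L(X)$) over a Tychonoff space $X$ is a topological vector space (respectively, locally convex space) together with a continuous map $i$ from $X$ into it such that every continuous map $f$ from $X$ to a topological vector space (respectively, locally convex space) $E$ gives rise to a unique continuous linear operator $\bar f$ from $\mathbb{V}(X)$ (respectively, $L(X)$) to $E$ with $f=\bar f\circ i$. Both exist, are essentially unique and Hausdorff, and in both cases $i$ is a topological embedding whose image is a Hamel basis; so both spaces are identified algebraically with the vector space $\mathbb{V}_X$ with basis $X$, and $x\in X$ is identified with $i(x)$. The universal uniformity $\mathcal{U}_X$ is the finest uniformity on $X$ compatible with the topology of $X$; its elements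 are entourages $V\subseteq X\times X$. For $\{V_n\}\in\mathcal{U}_X^{\mathbb{N}}$ and $\{\phi_n\}\in(\mathbb{R}^X_{>0})^{\mathbb{N}}$, the following subsets of $\mathbb{V}_X$ are defined: \[ \sum_{n\in\mathbb{N}} V_{n} := \bigcup_{m\in\mathbb{N}} \left\{ \sum_{n=1}^m t_n (x_n-y_n): |t_n|\leq 1 \text{ and } (x_n,y_n)\in V_{n} \text{ for all } n\leq m\right\}, \] \[ \sum_{n\in\mathbb{N}} \frac{1}{\phi_n} X := \bigcup_{m\in\mathbb{N}} \left\{ \sum_{n=1}^m t_n x_n: x_n \in X \text{ and } |t_n| \leq \frac{1}{\phi_n(x_n)} \text{ for all } n\leq m \right\}, \] and the sum of the two sets is the Minkowski sum. *)

theory Defs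
  imports "HOL-Analysis.Analysis" "HOL-Analysis.Finite_Function_Topology"
begin

text \<open>Uniformities are given by their entourages, with an explicit carrier \<open>S\<close>; the topology
  induced by \<open>U\<close> has the sets \<open>V `` {x}\<close> (\<open>V \<in> U\<close>) as neighbourhoods of \<open>x\<close>.\<close>

definition uniformity_in :: "'a set \<Rightarrow> ('a \<times> 'a) set set \<Rightarrow> bool" where
  "uniformity_in S U \<longleftrightarrow>
     S \<times> S \<in> U \<and>
     (\<forall>V\<in>U. Id_on S \<subseteq> V \<and> V \<subseteq> S \<times> S) \<and>
     (\<forall>V\<in>U. \<forall>W. V \<subseteq> W \<and> W \<subseteq> S \<times> S \<longrightarrow> W \<in> U) \<and>
     (\<forall>V\<in>U. \<forall>W\<in>U. V \<inter> W \<in> U) \<and>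
     (\<forall>V\<in>U. V\<inverse> \<in> U) \<and>
     (\<forall>V\<in>U. \<exists>W\<in>U. W O W \<subseteq> V)"

definition compatible_uniformity :: "'a topology \<Rightarrow> ('a \<times> 'a) set set \<Rightarrow> bool" where
  "compatible_uniformity X U \<longleftrightarrow>
     uniformity_in (topspace X) U \<and>
     (\<forall>G. openin X G \<longleftrightarrow> G \<subseteq> topspace X \<and> (\<forall>x\<in>G. \<exists>V\<in>U. V `` {x} \<subseteq> G))"

text \<open>The greatest element, with respect to inclusion, among the compatible uniformities.\<close>

definition universal_uniformity :: "'a topology \<Rightarrow> ('a \<times> 'a) set set" where
  "universal_uniformity X = (GREATEST U. compatible_uniformity X U)"

text \<open>A topological vector space is a topology whose underlying set is a linear subspace of a
  real vector space type. No separation axiom is imposed.\<close>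

definition tvs :: "'v::real_vector topology \<Rightarrow> bool" where
  "tvs E \<longleftrightarrow>
     subspace (topspace E) \<and>
     continuous_map (prod_topology E E) E (\<lambda>(x, y). x + y) \<and>
     continuous_map (prod_topology euclideanreal E) E (\<lambda>(c, x). c *\<^sub>R x)"

definition lctvs :: "'v::real_vector topology \<Rightarrow> bool" where
  "lctvs E \<longleftrightarrow> tvs E \<and> neighbourhood_base_at 0 convex E"

definition linear_in :: "'v::real_vector set \<Rightarrow> ('v \<Rightarrow> 'w::real_vector) \<Rightarrow> bool" where
  "linear_in S g \<longleftrightarrow>
     (\<forall>u\<in>S. \<forall>v\<in>S. g (u + v) = g u + g v) \<and> (\<forall>c. \<forall>v\<in>S. g (c *\<^sub>R v) = c *\<^sub>R g v)"

text \<open>The vector space with basis \<open>topspace X\<close>, as finitely supported real functions, and the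
  inclusion of its basis.\<close>

definition free_vs :: "'a topology \<Rightarrow> ('a \<Rightarrow>\<^sub>0 real) set" where
  "free_vs X = {p. Poly_Mapping.keys p \<subseteq> topspace X}"

definition basis_vec :: "'a \<Rightarrow> ('a \<Rightarrow>\<^sub>0 real)" where
  "basis_vec x = Poly_Mapping.single x 1"

text \<open>\<open>T\<close> is the topology of the free object over \<open>X\<close> in the class \<open>P\<close> of topological vector
  spaces, realised on \<open>free_vs X\<close>.
  The test spaces \<open>E\<close> range over all members of \<open>P\<close> carried by a subspace of \<open>'a \<Rightarrow>\<^sub>0 real\<close>. For
  \<open>P = tvs\<close> and \<open>P = lctvs\<close> this is no restriction: a map \<open>f\<close> from \<open>X\<close> to any space takes
  values in the span of its image, a subspace whose dimension is at most the cardinality of \<open>X\<close>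
  and which therefore is isomorphic to a subspace of \<open>'a \<Rightarrow>\<^sub>0 real\<close> with a transported topology.
  As extensions are determined only on \<open>free_vs X\<close>, uniqueness is stated for extensional
  functions.\<close>

definition free_topology_on_vs ::
    "(('a \<Rightarrow>\<^sub>0 real) topology \<Rightarrow> bool) \<Rightarrow> 'a topology \<Rightarrow> ('a \<Rightarrow>\<^sub>0 real) topology \<Rightarrow> bool" where
  "free_topology_on_vs P X T \<longleftrightarrow>
     topspace T = free_vs X \<and> P T \<and> continuous_map X T basis_vec \<and>
     (\<forall>E f. P E \<and> continuous_map X E f \<longrightarrow>
        (\<exists>!g. g \<in> extensional (free_vs X) \<and> linear_in (free_vs X) g \<and> continuous_map T E g \<and>
              (\<forall>x\<in>topspace X. f x = g (basis_vec x))))"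

definition is_free_tvs :: "'a topology \<Rightarrow> ('a \<Rightarrow>\<^sub>0 real) topology \<Rightarrow> bool" where
  "is_free_tvs X T \<longleftrightarrow> free_topology_on_vs tvs X T"

definition is_free_lctvs :: "'a topology \<Rightarrow> ('a \<Rightarrow>\<^sub>0 real) topology \<Rightarrow> bool" where
  "is_free_lctvs X T \<longleftrightarrow> free_topology_on_vs lctvs X T"

text \<open>Sequences are indexed from 1; the value at index 0 is irrelevant.\<close>

definition entourage_sum :: "(nat \<Rightarrow> ('a \<times> 'a) set) \<Rightarrow> ('a \<Rightarrow>\<^sub>0 real) set" where
  "entourage_sum V = (\<Union>m\<in>{1..}. {(\<Sum>n=1..m. t n *\<^sub>R (basis_vec (x n) - basis_vec (y n))) | t x y.
      \<forall>n\<in>{1..m}. \<bar>t n\<bar> \<le> 1 \<and> (x n, y n) \<in> V n})"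

definition weighted_sum :: "'a topology \<Rightarrow> (nat \<Rightarrow> 'a \<Rightarrow> real) \<Rightarrow> ('a \<Rightarrow>\<^sub>0 real) set" where
  "weighted_sum X \<phi> = (\<Union>m\<in>{1..}. {(\<Sum>n=1..m. t n *\<^sub>R basis_vec (x n)) | t x.
      \<forall>n\<in>{1..m}. x n \<in> topspace X \<and> \<bar>t n\<bar> \<le> 1 / \<phi> n (x n)})"

definition base_family :: "'a topology \<Rightarrow> ('a \<Rightarrow>\<^sub>0 real) set set" where
  "base_family X = {entourage_sum V + weighted_sum X \<phi> | V \<phi>.
      (\<forall>n\<ge>1. V n \<in> universal_uniformity X) \<and> (\<forall>n\<ge>1. \<forall>x\<in>topspace X. \<phi> n x > 0)}"

text \<open>Neighbourhoods need not be open. The first conjunct is not part of the library's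
  \<^const>\<open>neighbourhood_base_at\<close>, which does not require every member of the family to be a
  neighbourhood.\<close>

definition is_neighbourhood_base :: "'v topology \<Rightarrow> 'v \<Rightarrow> 'v set set \<Rightarrow> bool" where
  "is_neighbourhood_base T z F \<longleftrightarrow>
     (\<forall>W\<in>F. W \<subseteq> topspace T \<and> (\<exists>G. openin T G \<and> z \<in> G \<and> G \<subseteq> W)) \<and>
     neighbourhood_base_at z (\<lambda>W. W \<in> F) T"

end

theory Submission
  imports Defs
begin

text \<open>The free topology is compared with the vector topology generated by the given family.

  The sets in \<open>base_family X\<close> are balanced and absorbing, and they form a filter base in which
  every \<open>W\<close> contains some \<open>W' + W'\<close>
  (\<open>vector_topology_base_family\<close>): the last point holds because two sequences, one in each
  summand, can be interleaved into a single sequence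
  (\<open>series_sum_plus_subset\<close>). Such a family generates a vector topology on the free vector space
  (\<open>tvs_base_topology\<close>), and the basis embedding is continuous for it because \<open>y - x\<close> is a member
  of \<open>W\<close> as soon as \<open>(y, x)\<close> is in the first entourage. By the universal property the
  identity is continuous from the free topology to this one, so every \<open>W\<close> is a neighbourhood of
  zero (\<open>base_member_zero_neighbourhood\<close>).

  Conversely, let \<open>N\<close> be a zero neighbourhood of any vector topology on the free vector space that
  makes the basis embedding continuous. Choose balanced zero neighbourhoods with
  \<open>M 0 + M 0 \<subseteq> N\<close> and \<open>M (n + 1) + M (n + 1) \<subseteq> M n\<close>. The pairs with \<open>x - y \<in> M n\<close> form an
  entourage \<open>V n\<close> of the universal uniformity, and as \<open>M n\<close> is absorbing there is \<open>\<phi> n\<close> with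
  \<open>t x \<in> M n\<close> whenever \<open>\<bar>t\<bar> \<le> 1 / \<phi> n x\<close>. Telescoping puts both sums into \<open>M 0\<close>
  (\<open>series_sum_subset_halving\<close>), so the member of the family given by \<open>V\<close> and \<open>\<phi>\<close> lies in \<open>N\<close>
  (\<open>base_family_below_zero_neighbourhood\<close>).

  Taking convex hulls preserves the properties of a base and makes the generated topology locally
  convex, so the first argument applies to the hulls. For the second one, replace \<open>N\<close> by a convex
  neighbourhood \<open>C\<close>: a set \<open>W \<subseteq> C\<close> of the family has its hull in \<open>C\<close>.

  The universal uniformity is handled through a description by normal sequences of entourages
  (\<open>universal_uniformity_eq\<close>), in which complete regularity enters.\<close>

section \<open>Sums of sequences of sets\<close>

definition balanced :: "'v::real_vector set \<Rightarrow> bool" where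
  "balanced W \<longleftrightarrow> (\<forall>c v. \<bar>c\<bar> \<le> 1 \<longrightarrow> v \<in> W \<longrightarrow> c *\<^sub>R v \<in> W)"

lemma balancedD: "balanced W \<Longrightarrow> \<bar>c\<bar> \<le> 1 \<Longrightarrow> v \<in> W \<Longrightarrow> c *\<^sub>R v \<in> W"
  by (simp add: balanced_def)

lemma balanced_minus: "balanced W \<Longrightarrow> v \<in> W \<Longrightarrow> - v \<in> W"
  using balancedD[of W "-1" v] by simp

lemma balanced_shrink:
  assumes "balanced W" "e *\<^sub>R v \<in> W" "\<bar>c\<bar> \<le> e" "e > 0"
  shows "c *\<^sub>R v \<in> W"
  using balancedD[OF assms(1) _ assms(2), of "c / e"] assms(3,4) by simp

lemma balanced_plus: "balanced A \<Longrightarrow> balanced B \<Longrightarrow> balanced (A + B)"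
  unfolding balanced_def set_plus_def by (fastforce simp: scaleR_add_right)

lemma balanced_convex_hull:
  assumes "balanced W"
  shows "balanced (convex hull W)"
  unfolding balanced_def
proof (intro allI impI)
  fix c :: real and v
  assume c: "\<bar>c\<bar> \<le> 1" and v: "v \<in> convex hull W"
  have "(*\<^sub>R) c ` (convex hull W) = convex hull ((*\<^sub>R) c ` W)"
    by (rule convex_hull_scaling[symmetric])
  also have "\<dots> \<subseteq> convex hull W"
    using c by (intro hull_mono) (auto intro: balancedD[OF assms])
  finally show "c *\<^sub>R v \<in> convex hull W"
    using v by blast
qed

text \<open>Both summands of a member of \<open>base_family\<close> have this form: the \<open>n\<close>-th term is drawn from an
  \<open>n\<close>-th set. What follows about such sums is used for both.\<close>

definition series_sum :: "(nat \<Rightarrow> 'v::real_vector set) \<Rightarrow> 'v set" where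
  "series_sum A = (\<Union>m\<in>{1..}. {(\<Sum>n=1..m. a n) | a. \<forall>n\<in>{1..m}. a n \<in> A n})"

lemma mem_series_sum:
  "v \<in> series_sum A \<longleftrightarrow> (\<exists>m a. m \<ge> 1 \<and> (\<forall>n\<in>{1..m}. a n \<in> A n) \<and> v = (\<Sum>n=1..m. a n))"
  unfolding series_sum_def by blast

lemma series_sumI:
  assumes "\<And>n. n \<in> {1..m} \<Longrightarrow> a n \<in> A n" "0 \<in> A 1"
  shows "(\<Sum>n=1..m. a n) \<in> series_sum A"
proof (cases "m = 0")
  case True
  with assms(2) show ?thesis
    unfolding mem_series_sum by (intro exI[of _ 1] exI[of _ "\<lambda>_. 0"]) auto
next
  case False
  with assms(1) show ?thesis
    unfolding mem_series_sum by (intro exI[of _ m] exI[of _ a]) auto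
qed

text \<open>Zero is an admissible term, so a finite sum can be padded with zeros to any greater length.
  This brings two sums of different lengths to a common one.\<close>

lemma series_sumE:
  assumes "v \<in> series_sum A" "\<And>n. n \<ge> 1 \<Longrightarrow> 0 \<in> A n"
  obtains a m where "\<And>n. n \<ge> 1 \<Longrightarrow> a n \<in> A n" "\<And>M. M \<ge> m \<Longrightarrow> v = (\<Sum>n=1..M. a n)"
proof -
  obtain a m where a: "\<And>n. n \<in> {1..m} \<Longrightarrow> a n \<in> A n" and v: "v = (\<Sum>n=1..m. a n)"
    using assms(1) unfolding series_sum_def by blast
  define b where "b n = (if n \<in> {1..m} then a n else 0)" for n
  show thesis
  proof
    show "b n \<in> A n" if "n \<ge> 1" for n
      using that a assms(2) by (simp add: b_def)
    show "v = (\<Sum>n=1..M. b n)" if "M \<ge> m" for M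
      unfolding v b_def using that
      by (intro sum.mono_neutral_cong_left) auto
  qed
qed

lemma zero_in_series_sum: "0 \<in> A 1 \<Longrightarrow> 0 \<in> series_sum A"
  using series_sumI[of 0 _ A] by simp

lemma series_sum_mono: "(\<And>n. n \<ge> 1 \<Longrightarrow> A n \<subseteq> B n) \<Longrightarrow> series_sum A \<subseteq> series_sum B"
  unfolding subset_iff mem_series_sum by (metis atLeastAtMost_iff)

lemma balanced_series_sum:
  assumes "\<And>n. n \<ge> 1 \<Longrightarrow> balanced (A n)"
  shows "balanced (series_sum A)"
  unfolding balanced_def
proof (intro allI impI)
  fix c :: real and v
  assume c: "\<bar>c\<bar> \<le> 1" and "v \<in> series_sum A"
  then obtain a m where m: "m \<ge> 1" and a: "\<And>n. n \<in> {1..m} \<Longrightarrow> a n \<in> A n"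
    and v: "v = (\<Sum>n=1..m. a n)"
    unfolding mem_series_sum by blast
  have "c *\<^sub>R v = (\<Sum>n=1..m. c *\<^sub>R a n)"
    by (simp add: v scaleR_sum_right)
  moreover have "c *\<^sub>R a n \<in> A n" if "n \<in> {1..m}" for n
    using that assms a c by (auto intro: balancedD)
  ultimately show "c *\<^sub>R v \<in> series_sum A"
    unfolding mem_series_sum using m by (intro exI[of _ m] exI[of _ "\<lambda>n. c *\<^sub>R a n"]) simp
qed

lemma series_sum_subset_subspace:
  assumes "subspace L" "\<And>n. n \<ge> 1 \<Longrightarrow> A n \<subseteq> L"
  shows "series_sum A \<subseteq> L"
proof
  fix v assume "v \<in> series_sum A"
  then obtain m a where "\<forall>n\<in>{1..m}. a n \<in> A n" "v = (\<Sum>n=1..m. a n)"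
    unfolding mem_series_sum by blast
  moreover from this have "a n \<in> L" if "n \<in> {1..m}" for n
    using that assms(2)[of n] by auto
  ultimately show "v \<in> L" by (auto intro!: subspace_sum[OF assms(1)])
qed

text \<open>Interleaving: the terms of the first sum are put at the odd places \<open>2 k - 1\<close> and those of the
  second one at the even places \<open>2 k\<close>.\<close>

lemma series_sum_plus_subset:
  assumes zero: "\<And>n. n \<ge> 1 \<Longrightarrow> 0 \<in> A' n"
    and odd: "\<And>k. k \<ge> 1 \<Longrightarrow> A' k \<subseteq> A (2 * k - 1)"
    and even: "\<And>k. k \<ge> 1 \<Longrightarrow> A' k \<subseteq> A (2 * k)"
  shows "series_sum A' + series_sum A' \<subseteq> series_sum A"
proof
  fix w assume "w \<in> series_sum A' + series_sum A'"
  then obtain u v where w: "w = u + v" and u: "u \<in> series_sum A'" and v: "v \<in> series_sum A'"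
    by (auto elim: set_plus_elim)
  obtain a p where a: "\<And>n. n \<ge> 1 \<Longrightarrow> a n \<in> A' n"
    and ua: "\<And>M. M \<ge> p \<Longrightarrow> u = (\<Sum>n=1..M. a n)"
    using series_sumE[OF u zero] by blast
  obtain b q where b: "\<And>n. n \<ge> 1 \<Longrightarrow> b n \<in> A' n"
    and vb: "\<And>M. M \<ge> q \<Longrightarrow> v = (\<Sum>n=1..M. b n)"
    using series_sumE[OF v zero] by blast
  define c where "c n = (if even n then b (n div 2) else a (Suc n div 2))" for n
  have sum_c: "(\<Sum>n=1..2*M. c n) = (\<Sum>n=1..M. a n) + (\<Sum>n=1..M. b n)" for M
    by (induction M) (auto simp: c_def)
  have "c n \<in> A n" if "n \<in> {1..2 * (p + q)}" for n
  proof (cases "even n")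
    case True
    then obtain k where "n = 2 * k" by (auto elim: evenE)
    with that even[of k] b[of k] show ?thesis by (auto simp: c_def)
  next
    case False
    then obtain k where "n = 2 * k + 1" by (auto elim: oddE)
    with odd[of "Suc k"] a[of "Suc k"] show ?thesis by (auto simp: c_def)
  qed
  moreover have "0 \<in> A 1"
    using zero[of 1] odd[of 1] by auto
  ultimately have "(\<Sum>n=1..2*(p+q). c n) \<in> series_sum A"
    by (intro series_sumI)
  then show "w \<in> series_sum A"
    using w ua[of "p+q"] vb[of "p+q"] sum_c[of "p+q"] by simp
qed

text \<open>Telescoping from the tail: the terms after place \<open>k\<close> add up to an element of \<open>N k\<close>, because
  the term at place \<open>k + 1\<close> and the rest of the tail both lie in \<open>N (k + 1)\<close>.\<close>

lemma series_sum_subset_halving: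
  assumes A: "\<And>n. n \<ge> 1 \<Longrightarrow> A n \<subseteq> N n"
    and zero: "\<And>n. 0 \<in> N n" and half: "\<And>n. N (Suc n) + N (Suc n) \<subseteq> N n"
  shows "series_sum A \<subseteq> N 0"
proof
  fix v assume "v \<in> series_sum A"
  then obtain a m where a: "\<And>n. n \<in> {1..m} \<Longrightarrow> a n \<in> A n" and v: "v = (\<Sum>n=1..m. a n)"
    unfolding series_sum_def by blast
  have "(\<Sum>n=Suc k..m. a n) \<in> N k" if "k \<le> m" for k
    using that
  proof (induction k rule: inc_induct)
    case base
    show ?case using zero by simp
  next
    case (step k)
    have "a (Suc k) \<in> N (Suc k)"
      using a[of "Suc k"] A[of "Suc k"] step.hyps by auto
    then have "a (Suc k) + (\<Sum>n=Suc (Suc k)..m. a n) \<in> N (Suc k) + N (Suc k)"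
      using step.IH by (rule set_plus_intro)
    moreover have "(\<Sum>n=Suc k..m. a n) = a (Suc k) + (\<Sum>n=Suc (Suc k)..m. a n)"
      using step.hyps by (intro sum.atLeast_Suc_atMost) simp
    ultimately show ?case using half by auto
  qed
  from this[of 0] show "v \<in> N 0" by (simp add: v)
qed

section \<open>Vector topologies from bases at zero\<close>

definition zero_neighbourhood :: "'v::real_vector topology \<Rightarrow> 'v set \<Rightarrow> bool" where
  "zero_neighbourhood T N \<longleftrightarrow> N \<subseteq> topspace T \<and> (\<exists>G. openin T G \<and> 0 \<in> G \<and> G \<subseteq> N)"

lemma zero_neighbourhood_mem: "zero_neighbourhood T N \<Longrightarrow> 0 \<in> N"
  by (auto simp: zero_neighbourhood_def)

definition base_topology :: "'v::real_vector set \<Rightarrow> 'v set set \<Rightarrow> 'v topology" where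
  "base_topology L B = topology (\<lambda>G. G \<subseteq> L \<and> (\<forall>v\<in>G. \<exists>W\<in>B. (+) v ` W \<subseteq> G))"

text \<open>The classical conditions under which a family of sets is a base at zero of a vector topology;
  the carrier \<open>L\<close> is a subspace.\<close>

locale vector_topology_base =
  fixes L :: "'v::real_vector set" and B :: "'v set set"
  assumes subspace: "subspace L"
    and base_nonempty: "B \<noteq> {}"
    and base_subset: "W \<in> B \<Longrightarrow> W \<subseteq> L"
    and base_balanced: "W \<in> B \<Longrightarrow> balanced W"
    and base_absorbing: "W \<in> B \<Longrightarrow> v \<in> L \<Longrightarrow> \<exists>e>0. e *\<^sub>R v \<in> W"
    and base_inter: "W \<in> B \<Longrightarrow> W' \<in> B \<Longrightarrow> \<exists>W''\<in>B. W'' \<subseteq> W \<inter> W'"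
    and base_halving: "W \<in> B \<Longrightarrow> \<exists>W'\<in>B. W' + W' \<subseteq> W"
begin

lemma base_zero: "W \<in> B \<Longrightarrow> 0 \<in> W"
  using base_absorbing[of W 0] subspace_0[OF subspace] by auto

lemma openin_base_topology:
  "openin (base_topology L B) G \<longleftrightarrow> G \<subseteq> L \<and> (\<forall>v\<in>G. \<exists>W\<in>B. (+) v ` W \<subseteq> G)"
proof -
  have "istopology (\<lambda>G. G \<subseteq> L \<and> (\<forall>v\<in>G. \<exists>W\<in>B. (+) v ` W \<subseteq> G))"
    unfolding istopology_def
  proof (intro conjI allI impI)
    fix G H
    assume G: "G \<subseteq> L \<and> (\<forall>v\<in>G. \<exists>W\<in>B. (+) v ` W \<subseteq> G)"
      and H: "H \<subseteq> L \<and> (\<forall>v\<in>H. \<exists>W\<in>B. (+) v ` W \<subseteq> H)"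
    show "G \<inter> H \<subseteq> L" using G by blast
    show "\<forall>v\<in>G \<inter> H. \<exists>W\<in>B. (+) v ` W \<subseteq> G \<inter> H"
    proof
      fix v assume "v \<in> G \<inter> H"
      then obtain W W' where W: "W \<in> B" "(+) v ` W \<subseteq> G" "W' \<in> B" "(+) v ` W' \<subseteq> H"
        using G H by blast
      then obtain W'' where "W'' \<in> B" "W'' \<subseteq> W \<inter> W'" using base_inter by meson
      with W show "\<exists>W\<in>B. (+) v ` W \<subseteq> G \<inter> H" by (intro bexI[of _ W'']) blast+
    qed
  next
    fix K
    assume K: "\<forall>G\<in>K. G \<subseteq> L \<and> (\<forall>v\<in>G. \<exists>W\<in>B. (+) v ` W \<subseteq> G)"
    then show "\<Union> K \<subseteq> L" by blast
    show "\<forall>v\<in>\<Union> K. \<exists>W\<in>B. (+) v ` W \<subseteq> \<Union> K"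
      using K by (meson Union_iff Union_upper order_trans)
  qed
  then show ?thesis by (simp add: base_topology_def)
qed

lemma topspace_base_topology: "topspace (base_topology L B) = L"
proof
  show "topspace (base_topology L B) \<subseteq> L"
    using openin_topspace openin_base_topology by blast
  obtain W where "W \<in> B" using base_nonempty by blast
  then have "openin (base_topology L B) L"
    using base_subset by (auto simp: openin_base_topology intro!: bexI[of _ W] subspace_add[OF subspace])
  then show "L \<subseteq> topspace (base_topology L B)" by (rule openin_subset)
qed

text \<open>A member of the base need not be open. The points around which some translated member fits into
  \<open>v + W\<close> form an open set, by halving that member.\<close>

lemma base_neighbourhood:
  assumes "W \<in> B" "v \<in> L"
  obtains G where "openin (base_topology L B) G" "v \<in> G" "G \<subseteq> (+) v ` W"
proof
  define G where "G = {u \<in> L. \<exists>W'\<in>B. (+) u ` W' \<subseteq> (+) v ` W}"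
  show "openin (base_topology L B) G"
    unfolding openin_base_topology
  proof (intro conjI ballI)
    show "G \<subseteq> L" by (auto simp: G_def)
    fix u assume "u \<in> G"
    then obtain W1 where u: "u \<in> L" and W1: "W1 \<in> B" "(+) u ` W1 \<subseteq> (+) v ` W"
      by (auto simp: G_def)
    obtain W2 where W2: "W2 \<in> B" "W2 + W2 \<subseteq> W1" using base_halving W1(1) by blast
    have "u + x \<in> G" if x: "x \<in> W2" for x
    proof -
      have "u + x \<in> L" using u x base_subset[OF W2(1)] subspace_add[OF subspace] by blast
      moreover have "u + x + y \<in> (+) v ` W" if "y \<in> W2" for y
      proof -
        have "x + y \<in> W1" using W2(2) x that set_plus_intro by blast
        then have "u + (x + y) \<in> (+) v ` W" using W1(2) by blast
        then show ?thesis by (simp add: add.assoc)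
      qed
      ultimately show ?thesis unfolding G_def using W2(1) by blast
    qed
    then show "\<exists>W\<in>B. (+) u ` W \<subseteq> G" using W2(1) by blast
  qed
  show "v \<in> G" using assms by (auto simp: G_def)
  show "G \<subseteq> (+) v ` W"
  proof
    fix u assume "u \<in> G"
    then obtain W' where "W' \<in> B" "(+) u ` W' \<subseteq> (+) v ` W" by (auto simp: G_def)
    then have "u + 0 \<in> (+) v ` W" using base_zero by blast
    then show "u \<in> (+) v ` W" by simp
  qed
qed

text \<open>Halving gives \<open>2 W' \<subseteq> W' + W' \<subseteq> W\<close>, and this can be repeated.\<close>

lemma base_multiple_halving:
  assumes "W \<in> B"
  shows "\<exists>W'\<in>B. (*\<^sub>R) (2 ^ k) ` W' \<subseteq> W"
proof (induction k)
  case 0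
  show ?case using assms by auto
next
  case (Suc k)
  then obtain W1 where W1: "W1 \<in> B" "(*\<^sub>R) (2 ^ k) ` W1 \<subseteq> W" by blast
  obtain W2 where W2: "W2 \<in> B" "W2 + W2 \<subseteq> W1" using base_halving W1(1) by blast
  have "2 ^ Suc k *\<^sub>R x \<in> W" if "x \<in> W2" for x
  proof -
    have "x + x \<in> W1" using W2(2) that set_plus_intro by blast
    then have "2 ^ k *\<^sub>R (x + x) \<in> W" using W1(2) by blast
    moreover have "2 ^ Suc k *\<^sub>R x = 2 ^ k *\<^sub>R (x + x)"
      by (metis power_Suc2 scaleR_2 scaleR_scaleR)
    ultimately show ?thesis by simp
  qed
  with W2(1) show ?case by blast
qed

lemma base_multiple:
  assumes "W \<in> B"
  shows "\<exists>W'\<in>B. \<forall>c v. \<bar>c\<bar> \<le> b \<longrightarrow> v \<in> W' \<longrightarrow> c *\<^sub>R v \<in> W"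
proof -
  obtain k where k: "b < 2 ^ k" using real_arch_pow[of 2 b] by auto
  obtain W' where W': "W' \<in> B" "(*\<^sub>R) (2 ^ k) ` W' \<subseteq> W" using base_multiple_halving assms by blast
  have "c *\<^sub>R v \<in> W" if "\<bar>c\<bar> \<le> b" "v \<in> W'" for c v
  proof (rule balanced_shrink[OF base_balanced[OF assms]])
    show "2 ^ k *\<^sub>R v \<in> W" using that W'(2) by blast
    show "\<bar>c\<bar> \<le> 2 ^ k" using that k by linarith
  qed simp
  with W'(1) show ?thesis by blast
qed

lemma continuous_add_base_topology:
  "continuous_map (prod_topology (base_topology L B) (base_topology L B)) (base_topology L B)
     (\<lambda>(x, y). x + y)"
  unfolding continuous_map_eq_topcontinuous_at
proof
  fix p assume "p \<in> topspace (prod_topology (base_topology L B) (base_topology L B))"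
  then obtain x y where p: "p = (x, y)" and x: "x \<in> L" and y: "y \<in> L"
    by (auto simp: topspace_base_topology)
  have "\<exists>U. openin (prod_topology (base_topology L B) (base_topology L B)) U \<and> p \<in> U \<and>
         (\<forall>q\<in>U. (case q of (x, y) \<Rightarrow> x + y) \<in> G)"
    if G: "openin (base_topology L B) G" "x + y \<in> G" for G
  proof -
    obtain W where W: "W \<in> B" "(+) (x + y) ` W \<subseteq> G"
      using G by (auto simp: openin_base_topology)
    obtain W' where W': "W' \<in> B" "W' + W' \<subseteq> W" using base_halving W(1) by blast
    obtain H where H: "openin (base_topology L B) H" "x \<in> H" "H \<subseteq> (+) x ` W'"
      using base_neighbourhood[OF W'(1) x] by blast
    obtain K where K: "openin (base_topology L B) K" "y \<in> K" "K \<subseteq> (+) y ` W'"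
      using base_neighbourhood[OF W'(1) y] by blast
    have "u + v \<in> G" if "u \<in> H" "v \<in> K" for u v
    proof -
      obtain a b where ab: "a \<in> W'" "u = x + a" "b \<in> W'" "v = y + b"
        using H(3) K(3) \<open>u \<in> H\<close> \<open>v \<in> K\<close> by blast
      then have "a + b \<in> W" using W'(2) set_plus_intro by blast
      then have "(x + y) + (a + b) \<in> G" using W(2) by blast
      then show ?thesis by (simp add: ab algebra_simps)
    qed
    then show ?thesis
      using H K p by (intro exI[of _ "H \<times> K"]) (auto simp: openin_prod_Times_iff)
  qed
  then show "topcontinuous_at (prod_topology (base_topology L B) (base_topology L B))
      (base_topology L B) (\<lambda>(x, y). x + y) p"
    unfolding topcontinuous_at_def using x y p subspace_add[OF subspace]
    by (auto simp: topspace_base_topology)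
qed

text \<open>With \<open>u = x + a\<close> the difference \<open>d u - c x\<close> is \<open>(d - c) x + d a\<close>. The first summand is small by
  absorption; the second one because the scalars \<open>d\<close> near \<open>c\<close> are bounded by \<open>\<bar>c\<bar> + e\<close>.\<close>

lemma continuous_scaleR_base_topology:
  "continuous_map (prod_topology euclideanreal (base_topology L B)) (base_topology L B)
     (\<lambda>(c, x). c *\<^sub>R x)"
  unfolding continuous_map_eq_topcontinuous_at
proof
  fix p assume "p \<in> topspace (prod_topology euclideanreal (base_topology L B))"
  then obtain c x where p: "p = (c, x)" and x: "x \<in> L"
    by (auto simp: topspace_base_topology)
  have "\<exists>U. openin (prod_topology euclideanreal (base_topology L B)) U \<and> p \<in> U \<and>
         (\<forall>q\<in>U. (case q of (c, x) \<Rightarrow> c *\<^sub>R x) \<in> G)"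
    if G: "openin (base_topology L B) G" "c *\<^sub>R x \<in> G" for G
  proof -
    obtain W where W: "W \<in> B" "(+) (c *\<^sub>R x) ` W \<subseteq> G"
      using G by (auto simp: openin_base_topology)
    obtain W1 where W1: "W1 \<in> B" "W1 + W1 \<subseteq> W" using base_halving W(1) by blast
    obtain e where e: "e > 0" "e *\<^sub>R x \<in> W1" using base_absorbing[OF W1(1) x] by blast
    obtain W2 where W2: "W2 \<in> B" "\<And>d v. \<bar>d\<bar> \<le> \<bar>c\<bar> + e \<Longrightarrow> v \<in> W2 \<Longrightarrow> d *\<^sub>R v \<in> W1"
      using base_multiple[OF W1(1), of "\<bar>c\<bar> + e"] by blast
    obtain H where H: "openin (base_topology L B) H" "x \<in> H" "H \<subseteq> (+) x ` W2"
      using base_neighbourhood[OF W2(1) x] by blast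
    have "d *\<^sub>R u \<in> G" if "d \<in> ball c e" "u \<in> H" for d u
    proof -
      obtain a where a: "a \<in> W2" "u = x + a" using H(3) \<open>u \<in> H\<close> by blast
      have d: "\<bar>d - c\<bar> < e" using that(1) by (simp add: dist_real_def abs_minus_commute)
      have "(d - c) *\<^sub>R x \<in> W1"
        using d e by (intro balanced_shrink[OF base_balanced[OF W1(1)] e(2)]) auto
      moreover have "d *\<^sub>R a \<in> W1"
        using d a by (intro W2) auto
      ultimately have "(d - c) *\<^sub>R x + d *\<^sub>R a \<in> W" using W1(2) set_plus_intro by blast
      then have "c *\<^sub>R x + ((d - c) *\<^sub>R x + d *\<^sub>R a) \<in> G" using W(2) by blast
      then show ?thesis by (simp add: a algebra_simps)
    qed
    then show ?thesis
      using H p e by (intro exI[of _ "ball c e \<times> H"]) (auto simp: openin_prod_Times_iff)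
  qed
  then show "topcontinuous_at (prod_topology euclideanreal (base_topology L B))
      (base_topology L B) (\<lambda>(c, x). c *\<^sub>R x) p"
    unfolding topcontinuous_at_def using x p subspace_scale[OF subspace]
    by (auto simp: topspace_base_topology)
qed

lemma tvs_base_topology: "tvs (base_topology L B)"
  unfolding tvs_def topspace_base_topology
  using subspace continuous_add_base_topology continuous_scaleR_base_topology by blast

lemma lctvs_base_topology:
  assumes "\<And>W. W \<in> B \<Longrightarrow> convex W"
  shows "lctvs (base_topology L B)"
  unfolding lctvs_def neighbourhood_base_at_def
proof (intro conjI allI impI)
  show "tvs (base_topology L B)" by (rule tvs_base_topology)
  fix G assume "openin (base_topology L B) G \<and> 0 \<in> G"
  then obtain W where W: "W \<in> B" "(+) 0 ` W \<subseteq> G" by (auto simp: openin_base_topology)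
  obtain H where "openin (base_topology L B) H" "0 \<in> H" "H \<subseteq> (+) 0 ` W"
    using base_neighbourhood[OF W(1)] subspace_0[OF subspace] by blast
  with W show "\<exists>U V. openin (base_topology L B) U \<and> convex V \<and> 0 \<in> U \<and> U \<subseteq> V \<and> V \<subseteq> G"
    using assms by (intro exI[of _ H] exI[of _ W]) auto
qed

text \<open>Halving survives because the hull of a Minkowski sum is the sum of the hulls.\<close>

lemma vector_topology_base_convex_hull: "vector_topology_base L {convex hull W | W. W \<in> B}"
proof
  show "subspace L" by (rule subspace)
  show "{convex hull W | W. W \<in> B} \<noteq> {}" using base_nonempty by blast
next
  fix C v assume "C \<in> {convex hull W | W. W \<in> B}"
  then obtain W where W: "W \<in> B" and C: "C = convex hull W" by blast
  show "C \<subseteq> L"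
    unfolding C using base_subset[OF W] subspace_imp_convex[OF subspace] by (rule hull_minimal)
  show "balanced C"
    unfolding C by (rule balanced_convex_hull[OF base_balanced[OF W]])
  show "\<exists>e>0. e *\<^sub>R v \<in> C" if "v \<in> L"
    unfolding C using base_absorbing[OF W that] hull_subset by fast
  obtain W' where W': "W' \<in> B" "W' + W' \<subseteq> W" using base_halving[OF W] by blast
  then have "convex hull W' + convex hull W' \<subseteq> C"
    unfolding C convex_hull_set_plus[symmetric] by (intro hull_mono)
  with W' show "\<exists>C'\<in>{convex hull W | W. W \<in> B}. C' + C' \<subseteq> C" by blast
next
  fix C D assume "C \<in> {convex hull W | W. W \<in> B}" "D \<in> {convex hull W | W. W \<in> B}"
  then obtain W W' where W: "W \<in> B" "W' \<in> B" and CD: "C = convex hull W" "D = convex hull W'"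
    by blast
  obtain W'' where W'': "W'' \<in> B" "W'' \<subseteq> W \<inter> W'" using base_inter W by meson
  then have "convex hull W'' \<subseteq> C \<inter> D"
    unfolding CD using hull_mono[of W'' W convex] hull_mono[of W'' W' convex] by simp
  with W'' show "\<exists>E\<in>{convex hull W | W. W \<in> B}. E \<subseteq> C \<inter> D" by blast
qed

end

section \<open>Neighbourhoods of zero in a topological vector space\<close>

lemma tvs_continuous_add:
  assumes "tvs T" "continuous_map X T f" "continuous_map X T g"
  shows "continuous_map X T (\<lambda>x. f x + g x)"
proof -
  have "continuous_map X (prod_topology T T) (\<lambda>x. (f x, g x))"
    using assms by (simp add: continuous_map_pairedI)
  from continuous_map_compose[OF this] assms(1) show ?thesis
    unfolding tvs_def by (fastforce simp: o_def)
qed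

lemma tvs_continuous_scaleR:
  assumes "tvs T" "continuous_map X euclideanreal c" "continuous_map X T f"
  shows "continuous_map X T (\<lambda>x. c x *\<^sub>R f x)"
proof -
  have "continuous_map X (prod_topology euclideanreal T) (\<lambda>x. (c x, f x))"
    using assms by (simp add: continuous_map_pairedI)
  from continuous_map_compose[OF this] assms(1) show ?thesis
    unfolding tvs_def by (fastforce simp: o_def)
qed

text \<open>Continuity of scalar multiplication at \<open>(0, 0)\<close> gives \<open>d > 0\<close> and an open \<open>H\<close> with
  \<open>c v \<in> G\<close> for \<open>\<bar>c\<bar> \<le> d\<close> and \<open>v \<in> H\<close>. The balanced core of \<open>G\<close> therefore contains \<open>d H\<close>, which is
  open as the preimage of \<open>H\<close> under \<open>v \<mapsto> v / d\<close>.\<close>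

lemma tvs_balanced_neighbourhood:
  assumes T: "tvs T" and N: "zero_neighbourhood T N"
  shows "\<exists>N'. zero_neighbourhood T N' \<and> balanced N' \<and> N' \<subseteq> N"
proof -
  have sub: "subspace (topspace T)" using T by (simp add: tvs_def)
  obtain G where G: "openin T G" "0 \<in> G" "G \<subseteq> N" using N by (auto simp: zero_neighbourhood_def)
  have "continuous_map (prod_topology euclideanreal T) T (\<lambda>(c, x). c *\<^sub>R x)"
    using T by (simp add: tvs_def)
  from openin_continuous_map_preimage[OF this G(1)]
  have "openin (prod_topology euclideanreal T)
      {p \<in> topspace (prod_topology euclideanreal T). (case p of (c, x) \<Rightarrow> c *\<^sub>R x) \<in> G}" .
  moreover have "(0, 0) \<in> {p \<in> topspace (prod_topology euclideanreal T).
      (case p of (c, x) \<Rightarrow> c *\<^sub>R x) \<in> G}"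
    using G subspace_0[OF sub] by auto
  ultimately obtain C H where C: "openin euclideanreal C" "0 \<in> C" and H: "openin T H" "0 \<in> H"
    and CH: "C \<times> H \<subseteq> {p \<in> topspace (prod_topology euclideanreal T).
      (case p of (c, x) \<Rightarrow> c *\<^sub>R x) \<in> G}"
    unfolding openin_prod_topology_alt by meson
  obtain d where d: "d > 0" "cball 0 d \<subseteq> C"
    using C open_contains_cball[of C] by auto
  define N' where "N' = {v \<in> topspace T. \<forall>c. \<bar>c\<bar> \<le> 1 \<longrightarrow> c *\<^sub>R v \<in> G}"
  define K where "K = {v \<in> topspace T. inverse d *\<^sub>R v \<in> H}"
  have "continuous_map T T (\<lambda>v. inverse d *\<^sub>R v)"
    by (intro tvs_continuous_scaleR[OF T]) auto
  then have "openin T K"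
    unfolding K_def using H(1) by (rule openin_continuous_map_preimage)
  moreover have "0 \<in> K" using H subspace_0[OF sub] by (simp add: K_def)
  moreover have "K \<subseteq> N'"
  proof
    fix v assume v: "v \<in> K"
    have "c *\<^sub>R v \<in> G" if c: "\<bar>c\<bar> \<le> 1" for c
    proof -
      have "c * d \<in> C" using d c by (auto simp: abs_mult mult_left_le_one_le)
      moreover have "inverse d *\<^sub>R v \<in> H" using v by (simp add: K_def)
      ultimately have "(c * d) *\<^sub>R (inverse d *\<^sub>R v) \<in> G"
        using subsetD[OF CH, of "(c * d, inverse d *\<^sub>R v)"] by simp
      moreover have "c * d * inverse d = c" using d by simp
      ultimately show ?thesis by (simp only: scaleR_scaleR)
    qed
    with v show "v \<in> N'" by (simp add: K_def N'_def)
  qed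
  moreover have "balanced N'"
    unfolding balanced_def
  proof (intro allI impI)
    fix c :: real and v assume "\<bar>c\<bar> \<le> 1" "v \<in> N'"
    then show "c *\<^sub>R v \<in> N'"
      using subspace_scale[OF sub] by (auto simp: N'_def abs_mult mult_le_one)
  qed
  moreover have "N' \<subseteq> N"
  proof
    fix v assume "v \<in> N'"
    then have "1 *\<^sub>R v \<in> G" unfolding N'_def by (metis (mono_tags, lifting) abs_one mem_Collect_eq order_refl)
    with G show "v \<in> N" by auto
  qed
  ultimately show ?thesis
    unfolding zero_neighbourhood_def by (intro exI[of _ N']) (auto simp: N'_def)
qed

lemma tvs_halving:
  assumes T: "tvs T" and N: "zero_neighbourhood T N"
  shows "\<exists>N'. zero_neighbourhood T N' \<and> balanced N' \<and> N' + N' \<subseteq> N"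
proof -
  have sub: "subspace (topspace T)" using T by (simp add: tvs_def)
  obtain G where G: "openin T G" "0 \<in> G" "G \<subseteq> N" using N by (auto simp: zero_neighbourhood_def)
  have "continuous_map (prod_topology T T) T (\<lambda>(x, y). x + y)"
    using T by (simp add: tvs_def)
  from openin_continuous_map_preimage[OF this G(1)]
  have "openin (prod_topology T T)
      {p \<in> topspace (prod_topology T T). (case p of (x, y) \<Rightarrow> x + y) \<in> G}" .
  moreover have "(0, 0) \<in> {p \<in> topspace (prod_topology T T). (case p of (x, y) \<Rightarrow> x + y) \<in> G}"
    using G subspace_0[OF sub] by auto
  ultimately obtain H K where H: "openin T H" "0 \<in> H" and K: "openin T K" "0 \<in> K"
    and HK: "H \<times> K \<subseteq> {p \<in> topspace (prod_topology T T). (case p of (x, y) \<Rightarrow> x + y) \<in> G}"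
    unfolding openin_prod_topology_alt by meson
  have "zero_neighbourhood T (H \<inter> K)"
    unfolding zero_neighbourhood_def using H K openin_subset[OF H(1)] openin_Int[OF H(1) K(1)]
    by (intro conjI exI[of _ "H \<inter> K"]) auto
  then obtain N' where N': "zero_neighbourhood T N'" "balanced N'" "N' \<subseteq> H \<inter> K"
    using tvs_balanced_neighbourhood[OF T] by blast
  moreover have "N' + N' \<subseteq> N"
  proof
    fix w assume "w \<in> N' + N'"
    then obtain u v where "w = u + v" "u \<in> N'" "v \<in> N'" by (rule set_plus_elim)
    then show "w \<in> N" using subsetD[OF HK, of "(u, v)"] N'(3) G(3) by auto
  qed
  ultimately show ?thesis by blast
qed

lemma tvs_halving_sequence:
  assumes T: "tvs T" and N: "zero_neighbourhood T N"
  obtains M where "M 0 + M 0 \<subseteq> N" "\<And>n. zero_neighbourhood T (M n)" "\<And>n. balanced (M n)"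
    "\<And>n. M (Suc n) + M (Suc n) \<subseteq> M n"
proof -
  obtain M0 where M0: "zero_neighbourhood T M0" "balanced M0" "M0 + M0 \<subseteq> N"
    using tvs_halving[OF T N] by blast
  have "\<exists>M. \<forall>n. (zero_neighbourhood T (M n) \<and> balanced (M n) \<and> (n = 0 \<longrightarrow> M n = M0)) \<and>
      M (Suc n) + M (Suc n) \<subseteq> M n"
    using M0 tvs_halving[OF T]
    by (intro dependent_nat_choice[where Q = "\<lambda>n A B. B + B \<subseteq> A"]) auto
  then obtain M where "\<forall>n. (zero_neighbourhood T (M n) \<and> balanced (M n) \<and> (n = 0 \<longrightarrow> M n = M0)) \<and>
      M (Suc n) + M (Suc n) \<subseteq> M n" ..
  with M0 show thesis by (intro that[of M]) auto
qed

lemma tvs_absorbing: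
  assumes T: "tvs T" and N: "zero_neighbourhood T N" and v: "v \<in> topspace T"
  shows "\<exists>e>0. e *\<^sub>R v \<in> N"
proof -
  obtain G where G: "openin T G" "0 \<in> G" "G \<subseteq> N" using N by (auto simp: zero_neighbourhood_def)
  have "continuous_map euclideanreal T (\<lambda>c. c *\<^sub>R v)"
    using v by (intro tvs_continuous_scaleR[OF T]) auto
  from openin_continuous_map_preimage[OF this G(1)]
  have "open {c. c *\<^sub>R v \<in> G}" by simp
  then obtain e where "e > 0" "cball 0 e \<subseteq> {c. c *\<^sub>R v \<in> G}"
    using G(2) open_contains_cball_eq[of "{c. c *\<^sub>R v \<in> G}"]
    by (metis (mono_tags, lifting) mem_Collect_eq scaleR_zero_left)
  then have "e *\<^sub>R v \<in> G" using subsetD[of "cball 0 e" "{c. c *\<^sub>R v \<in> G}" e] by simp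
  with \<open>e > 0\<close> G(3) show ?thesis by blast
qed

section \<open>The universal uniformity\<close>

lemma uniformity_inD:
  assumes "uniformity_in S U" "V \<in> U"
  shows "Id_on S \<subseteq> V" "V \<subseteq> S \<times> S" "V\<inverse> \<in> U" "\<exists>W\<in>U. W O W \<subseteq> V"
    "W \<in> U \<Longrightarrow> V \<inter> W \<in> U"
proof -
  have U: "\<forall>V\<in>U. Id_on S \<subseteq> V \<and> V \<subseteq> S \<times> S" "\<forall>V\<in>U. \<forall>W\<in>U. V \<inter> W \<in> U"
    "\<forall>V\<in>U. V\<inverse> \<in> U" "\<forall>V\<in>U. \<exists>W\<in>U. W O W \<subseteq> V"
    using assms(1) unfolding uniformity_in_def by - (elim conjE, assumption)+
  show "Id_on S \<subseteq> V" "V \<subseteq> S \<times> S" "V\<inverse> \<in> U" "\<exists>W\<in>U. W O W \<subseteq> V"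
    using bspec[OF U(1) assms(2)] bspec[OF U(3) assms(2)] bspec[OF U(4) assms(2)] by blast+
  show "V \<inter> W \<in> U" if "W \<in> U"
    using bspec[OF bspec[OF U(2) assms(2)] that] .
qed

text \<open>A sequence of symmetric relations that witnesses, by successive square roots, that its first
  member belongs to a uniformity whose topology is coarser than that of \<open>X\<close>. Collecting the relations
  above such sequences gives the finest uniformity of this kind without reference to the family
  of all uniformities.\<close>

definition normal_sequence :: "'a topology \<Rightarrow> (nat \<Rightarrow> ('a \<times> 'a) set) \<Rightarrow> bool" where
  "normal_sequence X W \<longleftrightarrow> (\<forall>n. W n \<subseteq> topspace X \<times> topspace X \<and> Id_on (topspace X) \<subseteq> W n \<and>
     (W n)\<inverse> = W n \<and> W (Suc n) O W (Suc n) \<subseteq> W n \<and>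
     (\<forall>x\<in>topspace X. \<exists>G. openin X G \<and> x \<in> G \<and> G \<subseteq> W n `` {x}))"

definition normal_entourages :: "'a topology \<Rightarrow> ('a \<times> 'a) set set" where
  "normal_entourages X =
     {V. V \<subseteq> topspace X \<times> topspace X \<and> (\<exists>W. normal_sequence X W \<and> W 0 \<subseteq> V)}"

lemma normal_sequenceD:
  assumes "normal_sequence X W"
  shows "W n \<subseteq> topspace X \<times> topspace X" "Id_on (topspace X) \<subseteq> W n" "(W n)\<inverse> = W n"
    "W (Suc n) O W (Suc n) \<subseteq> W n"
    "x \<in> topspace X \<Longrightarrow> \<exists>G. openin X G \<and> x \<in> G \<and> G \<subseteq> W n `` {x}"
  using assms by (simp_all add: normal_sequence_def)

lemma normal_entouragesI:
  "normal_sequence X W \<Longrightarrow> W 0 \<subseteq> V \<Longrightarrow> V \<subseteq> topspace X \<times> topspace X \<Longrightarrow> V \<in> normal_entourages X"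
  by (auto simp: normal_entourages_def)

lemma normal_sequence_Suc: "normal_sequence X W \<Longrightarrow> normal_sequence X (\<lambda>n. W (Suc n))"
  by (simp add: normal_sequence_def)

lemma normal_sequence_Int:
  assumes "normal_sequence X W" "normal_sequence X W'"
  shows "normal_sequence X (\<lambda>n. W n \<inter> W' n)"
  unfolding normal_sequence_def
proof (intro allI conjI ballI)
  fix n
  show "W n \<inter> W' n \<subseteq> topspace X \<times> topspace X" "Id_on (topspace X) \<subseteq> W n \<inter> W' n"
    "(W n \<inter> W' n)\<inverse> = W n \<inter> W' n"
    using assms by (auto simp: normal_sequence_def)
  show "(W (Suc n) \<inter> W' (Suc n)) O (W (Suc n) \<inter> W' (Suc n)) \<subseteq> W n \<inter> W' n"
    using assms unfolding normal_sequence_def by blast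
  fix x assume "x \<in> topspace X"
  then obtain G H where "openin X G" "x \<in> G" "G \<subseteq> W n `` {x}" "openin X H" "x \<in> H" "H \<subseteq> W' n `` {x}"
    using assms unfolding normal_sequence_def by meson
  then show "\<exists>G. openin X G \<and> x \<in> G \<and> G \<subseteq> (W n \<inter> W' n) `` {x}"
    by (intro exI[of _ "G \<inter> H"]) auto
qed

lemma uniformity_in_normal_entourages: "uniformity_in (topspace X) (normal_entourages X)"
  unfolding uniformity_in_def
proof (intro conjI ballI allI impI)
  have "normal_sequence X (\<lambda>_. topspace X \<times> topspace X)"
    unfolding normal_sequence_def by auto
  then show "topspace X \<times> topspace X \<in> normal_entourages X"
    unfolding normal_entourages_def by blast
next
  fix V assume V: "V \<in> normal_entourages X"
  then obtain W where W: "normal_sequence X W" "W 0 \<subseteq> V" and VS: "V \<subseteq> topspace X \<times> topspace X"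
    unfolding normal_entourages_def by blast
  show "Id_on (topspace X) \<subseteq> V" using normal_sequenceD(2)[OF W(1), of 0] W(2) by simp
  show "V \<subseteq> topspace X \<times> topspace X" by (rule VS)
  show "V' \<in> normal_entourages X" if "V \<subseteq> V' \<and> V' \<subseteq> topspace X \<times> topspace X" for V'
    using that W by (intro normal_entouragesI[OF W(1)]) auto
  show "V\<inverse> \<in> normal_entourages X"
    using normal_sequenceD(3)[OF W(1), of 0] W(2) VS by (intro normal_entouragesI[OF W(1)]) auto
  have "W (Suc 0) \<in> normal_entourages X"
    using normal_sequenceD(1)[OF W(1)] by (intro normal_entouragesI[OF normal_sequence_Suc[OF W(1)]]) auto
  moreover have "W (Suc 0) O W (Suc 0) \<subseteq> V"
    using normal_sequenceD(4)[OF W(1), of 0] W(2) by simp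
  ultimately show "\<exists>W\<in>normal_entourages X. W O W \<subseteq> V" by blast
  show "V \<inter> V' \<in> normal_entourages X" if "V' \<in> normal_entourages X" for V'
  proof -
    from that obtain W' where W': "normal_sequence X W'" "W' 0 \<subseteq> V'"
      unfolding normal_entourages_def by blast
    show ?thesis
      using VS W(2) W'(2) by (intro normal_entouragesI[OF normal_sequence_Int[OF W(1) W'(1)]]) auto
  qed
qed

lemma normal_entourage_neighbourhood:
  assumes "V \<in> normal_entourages X" "x \<in> topspace X"
  obtains G where "openin X G" "x \<in> G" "G \<subseteq> V `` {x}"
proof -
  obtain W where W: "normal_sequence X W" "W 0 \<subseteq> V"
    using assms(1) unfolding normal_entourages_def by blast
  with normal_sequenceD(5)[OF W(1) assms(2), of 0] that show thesis by blast
qed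

text \<open>A continuous function \<open>f\<close> makes the relations \<open>\<bar>f a - f b\<bar> < (1/2)^n\<close> a normal sequence.\<close>

lemma function_entourage:
  assumes f: "continuous_map X euclideanreal f"
  shows "{(a, b). a \<in> topspace X \<and> b \<in> topspace X \<and> \<bar>f a - f b\<bar> < 1} \<in> normal_entourages X"
proof -
  define W where
    "W n = {(a, b). a \<in> topspace X \<and> b \<in> topspace X \<and> \<bar>f a - f b\<bar> < (1/2) ^ n}" for n :: nat
  have "normal_sequence X W"
    unfolding normal_sequence_def
  proof (intro allI conjI ballI)
    fix n
    show "W n \<subseteq> topspace X \<times> topspace X" "Id_on (topspace X) \<subseteq> W n" "(W n)\<inverse> = W n"
      by (auto simp: W_def abs_minus_commute)
    show "W (Suc n) O W (Suc n) \<subseteq> W n"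
    proof clarify
      fix a b c assume ab: "(a, b) \<in> W (Suc n)" and bc: "(b, c) \<in> W (Suc n)"
      have "\<bar>f a - f c\<bar> \<le> \<bar>f a - f b\<bar> + \<bar>f b - f c\<bar>" by simp
      also have "\<dots> < (1/2) ^ Suc n + (1/2) ^ Suc n"
        using ab bc by (intro add_strict_mono) (simp_all add: W_def)
      finally show "(a, c) \<in> W n" using ab bc by (simp add: W_def)
    qed
    fix x assume x: "x \<in> topspace X"
    have "openin X {y \<in> topspace X. f y \<in> ball (f x) ((1/2) ^ n)}"
      using f by (rule openin_continuous_map_preimage) simp
    then show "\<exists>G. openin X G \<and> x \<in> G \<and> G \<subseteq> W n `` {x}"
      using x by (intro exI[of _ "{y \<in> topspace X. f y \<in> ball (f x) ((1/2) ^ n)}"])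
        (auto simp: W_def dist_real_def)
  qed
  then show ?thesis by (rule normal_entouragesI) (auto simp: W_def)
qed

text \<open>Complete regularity gives enough entourages: if \<open>f x = 0\<close> and \<open>f = 1\<close> off \<open>G\<close>, then the points at
  \<open>f\<close>-distance less than 1 from \<open>x\<close> lie in \<open>G\<close>.\<close>

lemma compatible_normal_entourages:
  assumes "completely_regular_space X"
  shows "compatible_uniformity X (normal_entourages X)"
  unfolding compatible_uniformity_def
proof (intro conjI allI iffI)
  show "uniformity_in (topspace X) (normal_entourages X)"
    by (rule uniformity_in_normal_entourages)
  fix G
  show "\<forall>x\<in>G. \<exists>V\<in>normal_entourages X. V `` {x} \<subseteq> G" if G: "openin X G"
  proof
    fix x assume x: "x \<in> G"
    obtain f where f: "continuous_map X euclideanreal f" "f x = 0" "f ` (topspace X - G) \<subseteq> {1}"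
      using assms G x unfolding completely_regular_space_alt' by metis
    have "{(a, b). a \<in> topspace X \<and> b \<in> topspace X \<and> \<bar>f a - f b\<bar> < 1} `` {x} \<subseteq> G"
      using f by force
    with function_entourage[OF f(1)] show "\<exists>V\<in>normal_entourages X. V `` {x} \<subseteq> G" by blast
  qed
  show "G \<subseteq> topspace X" if "openin X G" using that by (rule openin_subset)
  show "openin X G" if G: "G \<subseteq> topspace X \<and> (\<forall>x\<in>G. \<exists>V\<in>normal_entourages X. V `` {x} \<subseteq> G)"
    unfolding openin_subopen[of X G]
  proof
    fix x assume "x \<in> G"
    with G obtain V where V: "V \<in> normal_entourages X" "V `` {x} \<subseteq> G" "x \<in> topspace X" by blast
    obtain H where "openin X H" "x \<in> H" "H \<subseteq> V `` {x}"
      using normal_entourage_neighbourhood[OF V(1,3)] by blast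
    with V show "\<exists>H. openin X H \<and> x \<in> H \<and> H \<subseteq> G" by blast
  qed
qed

lemma compatible_entourage_neighbourhood:
  assumes U: "compatible_uniformity X U" and V: "V \<in> U" and x: "x \<in> topspace X"
  shows "\<exists>G. openin X G \<and> x \<in> G \<and> G \<subseteq> V `` {x}"
proof -
  have unif: "uniformity_in (topspace X) U" using U by (simp add: compatible_uniformity_def)
  define G where "G = {y \<in> topspace X. \<exists>W\<in>U. W `` {y} \<subseteq> V `` {x}}"
  have "\<exists>W\<in>U. W `` {y} \<subseteq> G" if "y \<in> G" for y
  proof -
    obtain W where W: "W \<in> U" "W `` {y} \<subseteq> V `` {x}" using \<open>y \<in> G\<close> by (auto simp: G_def)
    obtain W' where W': "W' \<in> U" "W' O W' \<subseteq> W"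
      using uniformity_inD(4)[OF unif W(1)] by blast
    have "z \<in> G" if z: "(y, z) \<in> W'" for z
    proof -
      have "z \<in> topspace X" using z uniformity_inD(2)[OF unif W'(1)] by blast
      moreover have "W' `` {z} \<subseteq> V `` {x}" using z W W' by blast
      ultimately show ?thesis unfolding G_def using W'(1) by blast
    qed
    then have "W' `` {y} \<subseteq> G" by blast
    with W'(1) show ?thesis by blast
  qed
  then have "openin X G" using U unfolding compatible_uniformity_def G_def by auto
  moreover have "x \<in> G" using x V by (auto simp: G_def)
  moreover have "G \<subseteq> V `` {x}"
    unfolding G_def using uniformity_inD(1)[OF unif] by (blast intro: Id_onI)
  ultimately show ?thesis by blast
qed

text \<open>In any compatible uniformity a normal sequence is obtained by repeatedly choosing symmetric
  square roots.\<close>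

lemma compatible_uniformity_le:
  assumes U: "compatible_uniformity X U"
  shows "U \<subseteq> normal_entourages X"
proof
  have unif: "uniformity_in (topspace X) U" using U by (simp add: compatible_uniformity_def)
  have sym: "\<exists>W\<in>U. W\<inverse> = W \<and> W \<subseteq> V" if "V \<in> U" for V
    using uniformity_inD(5)[OF unif that uniformity_inD(3)[OF unif that]]
    by (intro bexI[of _ "V \<inter> V\<inverse>"]) auto
  fix V assume V: "V \<in> U"
  have "\<exists>W. \<forall>n. (W n \<in> U \<and> (W n)\<inverse> = W n \<and> W n \<subseteq> V) \<and> W (Suc n) O W (Suc n) \<subseteq> W n"
  proof (rule dependent_nat_choice)
    show "\<exists>W. W \<in> U \<and> W\<inverse> = W \<and> W \<subseteq> V" using sym[OF V] by blast
    fix W and n :: nat assume W: "W \<in> U \<and> W\<inverse> = W \<and> W \<subseteq> V"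
    then obtain W1 where W1: "W1 \<in> U" "W1 O W1 \<subseteq> W"
      using uniformity_inD(4)[OF unif] by meson
    obtain W2 where W2: "W2 \<in> U" "W2\<inverse> = W2" "W2 \<subseteq> W1" using sym[OF W1(1)] by blast
    have "Id_on (topspace X) \<subseteq> W2" "W2 \<subseteq> topspace X \<times> topspace X"
      using uniformity_inD(1,2)[OF unif W2(1)] by auto
    then have "W2 \<subseteq> W2 O W2" by (auto simp: Id_on_def)
    moreover have "W2 O W2 \<subseteq> W" using W1(2) W2(3) by blast
    ultimately show "\<exists>W'. (W' \<in> U \<and> W'\<inverse> = W' \<and> W' \<subseteq> V) \<and> W' O W' \<subseteq> W"
      using W2(1,2) W by (intro exI[of _ W2]) (meson order_trans)
  qed
  then obtain W where W: "\<And>n. W n \<in> U" "\<And>n. (W n)\<inverse> = W n" "\<And>n. W n \<subseteq> V"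
    "\<And>n. W (Suc n) O W (Suc n) \<subseteq> W n" by blast
  have "normal_sequence X W"
    unfolding normal_sequence_def
  proof (intro allI conjI ballI)
    show "W n \<subseteq> topspace X \<times> topspace X" "Id_on (topspace X) \<subseteq> W n" for n
      using uniformity_inD(1,2)[OF unif W(1)] by auto
  qed (use W compatible_entourage_neighbourhood[OF U W(1)] in simp_all)
  then show "V \<in> normal_entourages X"
    using W(3) uniformity_inD(2)[OF unif V] by (intro normal_entouragesI) auto
qed

lemma universal_uniformity_eq:
  assumes "completely_regular_space X"
  shows "universal_uniformity X = normal_entourages X"
  unfolding universal_uniformity_def
proof (rule Greatest_equality)
  show "compatible_uniformity X (normal_entourages X)"
    by (rule compatible_normal_entourages[OF assms])
qed (rule compatible_uniformity_le)

text \<open>The shifted sequence \<open>M n, M (n + 1), \<dots>\<close> gives a normal sequence that begins with this relation.\<close>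

lemma tvs_entourage:
  assumes T: "tvs T" and f: "continuous_map X T f"
    and M: "\<And>n. zero_neighbourhood T (M n)" "\<And>n. balanced (M n)"
      "\<And>n. M (Suc n) + M (Suc n) \<subseteq> M n"
  shows "{(x, y). x \<in> topspace X \<and> y \<in> topspace X \<and> f x - f y \<in> M n} \<in> normal_entourages X"
proof -
  define W where "W k = {(x, y). x \<in> topspace X \<and> y \<in> topspace X \<and> f x - f y \<in> M (n + k)}" for k
  have "normal_sequence X W"
    unfolding normal_sequence_def
  proof (intro allI conjI ballI)
    fix k
    show "W k \<subseteq> topspace X \<times> topspace X" by (auto simp: W_def)
    show "Id_on (topspace X) \<subseteq> W k"
      using zero_neighbourhood_mem[OF M(1)] by (auto simp: W_def)
    show "(W k)\<inverse> = W k"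
      unfolding W_def using balanced_minus[OF M(2)] by fastforce
    show "W (Suc k) O W (Suc k) \<subseteq> W k"
    proof clarify
      fix x y z assume xy: "(x, y) \<in> W (Suc k)" and yz: "(y, z) \<in> W (Suc k)"
      then have "(f x - f y) + (f y - f z) \<in> M (Suc (n + k)) + M (Suc (n + k))"
        unfolding W_def by (intro set_plus_intro) auto
      then have "f x - f z \<in> M (n + k)" using M(3) by auto
      with xy yz show "(x, z) \<in> W k" by (auto simp: W_def)
    qed
    fix x assume x: "x \<in> topspace X"
    obtain G where G: "openin T G" "0 \<in> G" "G \<subseteq> M (n + k)"
      using M(1) unfolding zero_neighbourhood_def by blast
    have "continuous_map X T (\<lambda>y. f x + (-1) *\<^sub>R f y)"
      using x f continuous_map_image_subset_topspace[OF f]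
      by (intro tvs_continuous_add[OF T] tvs_continuous_scaleR[OF T]) auto
    from openin_continuous_map_preimage[OF this G(1)]
    have "openin X {y \<in> topspace X. f x - f y \<in> G}" by simp
    then show "\<exists>G. openin X G \<and> x \<in> G \<and> G \<subseteq> W k `` {x}"
      using x G by (intro exI[of _ "{y \<in> topspace X. f x - f y \<in> G}"]) (auto simp: W_def)
  qed
  then show ?thesis by (rule normal_entouragesI) (auto simp: W_def)
qed

section \<open>The family of basic sets\<close>

definition entourage_piece :: "('a \<times> 'a) set \<Rightarrow> ('a \<Rightarrow>\<^sub>0 real) set" where
  "entourage_piece V = {t *\<^sub>R (basis_vec x - basis_vec y) | t x y. \<bar>t\<bar> \<le> 1 \<and> (x, y) \<in> V}"

definition weighted_piece :: "'a set \<Rightarrow> ('a \<Rightarrow> real) \<Rightarrow> ('a \<Rightarrow>\<^sub>0 real) set" where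
  "weighted_piece S \<phi> = {t *\<^sub>R basis_vec x | t x. x \<in> S \<and> \<bar>t\<bar> \<le> 1 / \<phi> x}"

lemma entourage_sum_eq: "entourage_sum V = series_sum (\<lambda>n. entourage_piece (V n))"
proof (intro set_eqI iffI)
  fix v assume "v \<in> entourage_sum V"
  then obtain m t x y where "m \<in> {1..}" "v = (\<Sum>n=1..m. t n *\<^sub>R (basis_vec (x n) - basis_vec (y n)))"
    "\<forall>n\<in>{1..m}. \<bar>t n\<bar> \<le> 1 \<and> (x n, y n) \<in> V n"
    unfolding entourage_sum_def by blast
  then show "v \<in> series_sum (\<lambda>n. entourage_piece (V n))"
    unfolding mem_series_sum entourage_piece_def
    by (intro exI[of _ m] exI[of _ "\<lambda>n. t n *\<^sub>R (basis_vec (x n) - basis_vec (y n))"]) blast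
next
  fix v assume "v \<in> series_sum (\<lambda>n. entourage_piece (V n))"
  then obtain m a where m: "m \<ge> 1" "v = (\<Sum>n=1..m. a n)" and
    a: "\<forall>n\<in>{1..m}. a n \<in> entourage_piece (V n)"
    unfolding mem_series_sum by blast
  from a have "\<forall>n\<in>{1..m}. \<exists>t x y. a n = t *\<^sub>R (basis_vec x - basis_vec y) \<and> \<bar>t\<bar> \<le> 1 \<and> (x, y) \<in> V n"
    unfolding entourage_piece_def by blast
  then obtain t x y where txy: "\<forall>n\<in>{1..m}. a n = t n *\<^sub>R (basis_vec (x n) - basis_vec (y n)) \<and>
      \<bar>t n\<bar> \<le> 1 \<and> (x n, y n) \<in> V n"
    by metis
  then have "v = (\<Sum>n=1..m. t n *\<^sub>R (basis_vec (x n) - basis_vec (y n)))"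
    unfolding m(2) by (intro sum.cong) auto
  with txy m(1) show "v \<in> entourage_sum V"
    unfolding entourage_sum_def by (intro UN_I[of m]) auto
qed

lemma weighted_sum_eq: "weighted_sum X \<phi> = series_sum (\<lambda>n. weighted_piece (topspace X) (\<phi> n))"
proof (intro set_eqI iffI)
  fix v assume "v \<in> weighted_sum X \<phi>"
  then obtain m t x where "m \<in> {1..}" "v = (\<Sum>n=1..m. t n *\<^sub>R basis_vec (x n))"
    "\<forall>n\<in>{1..m}. x n \<in> topspace X \<and> \<bar>t n\<bar> \<le> 1 / \<phi> n (x n)"
    unfolding weighted_sum_def by blast
  then show "v \<in> series_sum (\<lambda>n. weighted_piece (topspace X) (\<phi> n))"
    unfolding mem_series_sum weighted_piece_def
    by (intro exI[of _ m] exI[of _ "\<lambda>n. t n *\<^sub>R basis_vec (x n)"]) blast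
next
  fix v assume "v \<in> series_sum (\<lambda>n. weighted_piece (topspace X) (\<phi> n))"
  then obtain m a where m: "m \<ge> 1" "v = (\<Sum>n=1..m. a n)" and
    a: "\<forall>n\<in>{1..m}. a n \<in> weighted_piece (topspace X) (\<phi> n)"
    unfolding mem_series_sum by blast
  from a have "\<forall>n\<in>{1..m}. \<exists>t x. a n = t *\<^sub>R basis_vec x \<and> x \<in> topspace X \<and> \<bar>t\<bar> \<le> 1 / \<phi> n x"
    unfolding weighted_piece_def by blast
  then obtain t x where tx: "\<forall>n\<in>{1..m}. a n = t n *\<^sub>R basis_vec (x n) \<and>
      x n \<in> topspace X \<and> \<bar>t n\<bar> \<le> 1 / \<phi> n (x n)"
    by metis
  then have "v = (\<Sum>n=1..m. t n *\<^sub>R basis_vec (x n))"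
    unfolding m(2) by (intro sum.cong) auto
  with tx m(1) show "v \<in> weighted_sum X \<phi>"
    unfolding weighted_sum_def by (intro UN_I[of m]) auto
qed

lemma balanced_entourage_piece: "balanced (entourage_piece V)"
  unfolding balanced_def entourage_piece_def
  by (auto simp: abs_mult) (metis abs_mult mult_le_one abs_ge_zero)

lemma balanced_weighted_piece: "balanced (weighted_piece S \<phi>)"
  unfolding balanced_def weighted_piece_def
proof clarify
  fix c t :: real and x assume "\<bar>c\<bar> \<le> 1" "x \<in> S" "\<bar>t\<bar> \<le> 1 / \<phi> x"
  moreover from this have "\<bar>c * t\<bar> \<le> 1 / \<phi> x"
    by (metis abs_ge_zero abs_mult mult_left_le_one_le order_trans)
  ultimately show "\<exists>t' x'. c *\<^sub>R t *\<^sub>R basis_vec x = t' *\<^sub>R basis_vec x' \<and> x' \<in> S \<and> \<bar>t'\<bar> \<le> 1 / \<phi> x'"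
    by (intro exI[of _ "c * t"] exI[of _ x]) simp
qed

lemma entourage_piece_mono: "V \<subseteq> V' \<Longrightarrow> entourage_piece V \<subseteq> entourage_piece V'"
  unfolding entourage_piece_def by blast

lemma weighted_piece_antimono:
  assumes "\<And>x. x \<in> S \<Longrightarrow> 0 < \<phi> x" "\<And>x. x \<in> S \<Longrightarrow> \<phi> x \<le> \<phi>' x"
  shows "weighted_piece S \<phi>' \<subseteq> weighted_piece S \<phi>"
  unfolding weighted_piece_def
proof clarify
  fix t x assume x: "x \<in> S" and t: "\<bar>t\<bar> \<le> 1 / \<phi>' x"
  have "1 / \<phi>' x \<le> 1 / \<phi> x" using assms[OF x] by (intro divide_left_mono) auto
  with x t show "\<exists>t' x'. t *\<^sub>R basis_vec x = t' *\<^sub>R basis_vec x' \<and> x' \<in> S \<and> \<bar>t'\<bar> \<le> 1 / \<phi> x'"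
    by (intro exI[of _ t] exI[of _ x]) simp
qed

lemma lookup_scaleR: "Poly_Mapping.lookup (c *\<^sub>R p) x = c * Poly_Mapping.lookup p x"
  for p :: "'a \<Rightarrow>\<^sub>0 real"
proof -
  have "finite {i. c * Poly_Mapping.lookup p i \<noteq> 0}"
    by (rule finite_subset[OF _ finite_keys[of p]]) (auto simp: in_keys_iff)
  then show ?thesis by (simp add: scaleR_poly_mapping_def)
qed

lemma subspace_free_vs: "subspace (free_vs X)"
  unfolding subspace_def free_vs_def
proof (intro conjI ballI allI)
  fix p q :: "'a \<Rightarrow>\<^sub>0 real" and c :: real
  assume p: "p \<in> {p. Poly_Mapping.keys p \<subseteq> topspace X}"
  show "c *\<^sub>R p \<in> {p. Poly_Mapping.keys p \<subseteq> topspace X}"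
    using p by (auto simp: in_keys_iff lookup_scaleR)
  assume "q \<in> {p. Poly_Mapping.keys p \<subseteq> topspace X}"
  with p show "p + q \<in> {p. Poly_Mapping.keys p \<subseteq> topspace X}"
    using Poly_Mapping.keys_add[of p q] by blast
qed simp

lemma basis_vec_in_free_vs: "x \<in> topspace X \<Longrightarrow> basis_vec x \<in> free_vs X"
  by (simp add: basis_vec_def free_vs_def)

lemma sum_basis_vec: "v = (\<Sum>x\<in>Poly_Mapping.keys v. Poly_Mapping.lookup v x *\<^sub>R basis_vec x)"
proof (rule poly_mapping_eqI)
  fix y
  have "Poly_Mapping.lookup (\<Sum>x\<in>Poly_Mapping.keys v. Poly_Mapping.lookup v x *\<^sub>R basis_vec x) y
      = (\<Sum>x\<in>Poly_Mapping.keys v. Poly_Mapping.lookup v x * (if x = y then 1 else 0))"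
    by (simp add: lookup_sum lookup_scaleR basis_vec_def lookup_single when_def)
  also have "\<dots> = Poly_Mapping.lookup v y"
    by (simp add: if_distrib[of "\<lambda>t. _ * t"] in_keys_iff cong: if_cong)
  finally show "Poly_Mapping.lookup v y =
      Poly_Mapping.lookup (\<Sum>x\<in>Poly_Mapping.keys v. Poly_Mapping.lookup v x *\<^sub>R basis_vec x) y" ..
qed

text \<open>Every vector is the combination of its support, so a linear map that fixes the basis is the
  identity.\<close>

lemma linear_in_free_vs_eq_id:
  assumes g: "linear_in (free_vs X) g" and b: "\<And>x. x \<in> topspace X \<Longrightarrow> g (basis_vec x) = basis_vec x"
    and v: "v \<in> free_vs X"
  shows "g v = v"
proof -
  have sum_in: "(\<Sum>x\<in>F. c x *\<^sub>R basis_vec x) \<in> free_vs X" if "F \<subseteq> topspace X" for F and c :: "'a \<Rightarrow> real"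
    using that
    by (intro subspace_sum[OF subspace_free_vs] subspace_scale[OF subspace_free_vs]
        basis_vec_in_free_vs) auto
  have "g 0 = 0"
    using g subspace_0[OF subspace_free_vs] unfolding linear_in_def by (metis scaleR_zero_left)
  have "g (\<Sum>x\<in>F. c x *\<^sub>R basis_vec x) = (\<Sum>x\<in>F. c x *\<^sub>R basis_vec x)"
    if "finite F" "F \<subseteq> topspace X" for F and c :: "'a \<Rightarrow> real"
    using that
  proof (induction F rule: finite_induct)
    case empty
    show ?case using \<open>g 0 = 0\<close> by simp
  next
    case (insert x F)
    have "c x *\<^sub>R basis_vec x \<in> free_vs X"
      using insert.prems by (auto intro: subspace_scale[OF subspace_free_vs] basis_vec_in_free_vs)
    moreover have "g (c x *\<^sub>R basis_vec x) = c x *\<^sub>R basis_vec x"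
      using g b[of x] insert.prems basis_vec_in_free_vs[of x X] unfolding linear_in_def by simp
    ultimately show ?case
      using g sum_in[of F c] insert unfolding linear_in_def by auto
  qed
  from this[of "Poly_Mapping.keys v" "Poly_Mapping.lookup v"] v show ?thesis
    unfolding free_vs_def sum_basis_vec[of v, symmetric] by simp
qed

lemma base_familyI:
  assumes "\<And>n. n \<ge> 1 \<Longrightarrow> V n \<in> universal_uniformity X" "\<And>n x. n \<ge> 1 \<Longrightarrow> x \<in> topspace X \<Longrightarrow> \<phi> n x > 0"
  shows "entourage_sum V + weighted_sum X \<phi> \<in> base_family X"
  using assms unfolding base_family_def by blast

lemma base_familyE:
  assumes "W \<in> base_family X"
  obtains V \<phi> where "W = entourage_sum V + weighted_sum X \<phi>"
    "\<And>n. n \<ge> 1 \<Longrightarrow> V n \<in> universal_uniformity X"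
    "\<And>n x. n \<ge> 1 \<Longrightarrow> x \<in> topspace X \<Longrightarrow> \<phi> n x > 0"
  using assms unfolding base_family_def by blast

context
  fixes X :: "'a topology"
  assumes creg: "completely_regular_space X" and nonempty: "topspace X \<noteq> {}"
begin

lemma uniformity_in_universal: "uniformity_in (topspace X) (universal_uniformity X)"
  unfolding universal_uniformity_eq[OF creg] by (rule uniformity_in_normal_entourages)

lemmas entourage_subset = uniformity_inD(2)[OF uniformity_in_universal]
  and entourage_converse = uniformity_inD(3)[OF uniformity_in_universal]
  and entourage_Int = uniformity_inD(5)[OF uniformity_in_universal]

lemma entourage_refl: "V \<in> universal_uniformity X \<Longrightarrow> x \<in> topspace X \<Longrightarrow> (x, x) \<in> V"
  using uniformity_inD(1)[OF uniformity_in_universal] by blast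

lemma zero_in_entourage_piece: "V \<in> universal_uniformity X \<Longrightarrow> 0 \<in> entourage_piece V"
  using entourage_refl nonempty unfolding entourage_piece_def by fastforce

lemma zero_in_weighted_piece:
  assumes "\<And>x. x \<in> topspace X \<Longrightarrow> \<phi> x > 0"
  shows "0 \<in> weighted_piece (topspace X) \<phi>"
proof -
  obtain x where "x \<in> topspace X" using nonempty by blast
  with assms[of x] show ?thesis
    unfolding weighted_piece_def by (auto intro!: exI[of _ 0] exI[of _ x])
qed

lemma entourage_sum_subset_free_vs:
  assumes "\<And>n. n \<ge> 1 \<Longrightarrow> V n \<in> universal_uniformity X"
  shows "entourage_sum V \<subseteq> free_vs X"
  unfolding entourage_sum_eq
proof (rule series_sum_subset_subspace[OF subspace_free_vs])
  fix n :: nat assume "n \<ge> 1"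
  then show "entourage_piece (V n) \<subseteq> free_vs X"
    using entourage_subset[OF assms] unfolding entourage_piece_def
    by (auto intro!: subspace_scale[OF subspace_free_vs] subspace_diff[OF subspace_free_vs]
        basis_vec_in_free_vs)
qed

lemma weighted_sum_subset_free_vs: "weighted_sum X \<phi> \<subseteq> free_vs X"
  unfolding weighted_sum_eq
  by (rule series_sum_subset_subspace[OF subspace_free_vs])
    (auto simp: weighted_piece_def intro!: subspace_scale[OF subspace_free_vs] basis_vec_in_free_vs)

lemma zero_in_entourage_sum:
  "(\<And>n. n \<ge> 1 \<Longrightarrow> V n \<in> universal_uniformity X) \<Longrightarrow> 0 \<in> entourage_sum V"
  unfolding entourage_sum_eq by (intro zero_in_series_sum zero_in_entourage_piece) simp

lemma zero_in_weighted_sum: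
  "(\<And>n x. n \<ge> 1 \<Longrightarrow> x \<in> topspace X \<Longrightarrow> \<phi> n x > 0) \<Longrightarrow> 0 \<in> weighted_sum X \<phi>"
  unfolding weighted_sum_eq by (intro zero_in_series_sum zero_in_weighted_piece) simp

text \<open>The \<open>n\<close>-th term of the sum is used for the \<open>n\<close>-th point \<open>h n\<close> of the support of \<open>v\<close>. As the
  support is finite, one factor \<open>e\<close> is small enough for all the bounds \<open>1 / \<phi> n (h n)\<close>.\<close>

lemma weighted_sum_absorbing:
  assumes \<phi>: "\<And>n x. n \<ge> 1 \<Longrightarrow> x \<in> topspace X \<Longrightarrow> \<phi> n x > 0" and v: "v \<in> free_vs X"
  shows "\<exists>e>0. e *\<^sub>R v \<in> weighted_sum X \<phi>"
proof -
  define m where "m = card (Poly_Mapping.keys v)"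
  obtain h where h: "bij_betw h {1..m} (Poly_Mapping.keys v)"
    using ex_bij_betw_nat_finite_1[OF finite_keys[of v]] unfolding m_def by blast
  have hX: "h n \<in> topspace X" if "n \<in> {1..m}" for n
    using that bij_betwE[OF h] v by (auto simp: free_vs_def)
  \<comment> \<open>The summand 1 keeps \<open>c n\<close> positive, so that it can be divided by.\<close>
  define c where "c n = \<bar>Poly_Mapping.lookup v (h n)\<bar> + 1" for n
  define e where "e = Min (insert 1 ((\<lambda>n. 1 / (\<phi> n (h n) * c n)) ` {1..m}))"
  have c: "c n > 0" for n by (simp add: c_def add_nonneg_pos)
  have e: "e > 0" unfolding e_def using \<phi> hX c by auto
  have "\<bar>e * Poly_Mapping.lookup v (h n)\<bar> \<le> 1 / \<phi> n (h n)" if n: "n \<in> {1..m}" for n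
  proof -
    have "\<bar>e * Poly_Mapping.lookup v (h n)\<bar> \<le> e * c n"
      using e by (simp add: abs_mult c_def)
    also have "e \<le> 1 / (\<phi> n (h n) * c n)"
      unfolding e_def using n by (intro Min_le) auto
    then have "e * c n \<le> 1 / (\<phi> n (h n) * c n) * c n"
      using c[of n] by (intro mult_right_mono) auto
    also have "\<dots> = 1 / \<phi> n (h n)" using c[of n] by simp
    finally show ?thesis .
  qed
  then have "(\<Sum>n=1..m. (e * Poly_Mapping.lookup v (h n)) *\<^sub>R basis_vec (h n)) \<in> weighted_sum X \<phi>"
    unfolding weighted_sum_eq using hX \<phi>
    by (intro series_sumI zero_in_weighted_piece) (auto simp: weighted_piece_def)
  moreover have "e *\<^sub>R v = (\<Sum>n=1..m. (e * Poly_Mapping.lookup v (h n)) *\<^sub>R basis_vec (h n))"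
    by (subst (1) sum_basis_vec, subst sum.reindex_bij_betw[OF h, symmetric])
      (simp add: scaleR_sum_right)
  ultimately show ?thesis using e by auto
qed

lemma vector_topology_base_family: "vector_topology_base (free_vs X) (base_family X)"
proof
  show "subspace (free_vs X)" by (rule subspace_free_vs)
  have "topspace X \<times> topspace X \<in> universal_uniformity X"
    using uniformity_in_universal unfolding uniformity_in_def by (elim conjE)
  then have "entourage_sum (\<lambda>_. topspace X \<times> topspace X) + weighted_sum X (\<lambda>_ _. 1) \<in> base_family X"
    by (intro base_familyI) auto
  then show "base_family X \<noteq> {}" by blast
next
  fix W v assume "W \<in> base_family X"
  then obtain V \<phi> where W: "W = entourage_sum V + weighted_sum X \<phi>"
    and V: "\<And>n. n \<ge> 1 \<Longrightarrow> V n \<in> universal_uniformity X"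
    and \<phi>: "\<And>n x. n \<ge> 1 \<Longrightarrow> x \<in> topspace X \<Longrightarrow> \<phi> n x > 0"
    by (rule base_familyE) blast
  show "W \<subseteq> free_vs X"
    unfolding W using entourage_sum_subset_free_vs[of V, OF V] weighted_sum_subset_free_vs[of \<phi>]
    by (auto elim!: set_plus_elim intro!: subspace_add[OF subspace_free_vs])
  show "balanced W"
    unfolding W entourage_sum_eq weighted_sum_eq
    by (intro balanced_plus balanced_series_sum balanced_entourage_piece balanced_weighted_piece)
  show "\<exists>e>0. e *\<^sub>R v \<in> W" if v: "v \<in> free_vs X"
  proof -
    obtain e where "e > 0" "e *\<^sub>R v \<in> weighted_sum X \<phi>"
      using weighted_sum_absorbing[of \<phi>, OF \<phi> v] by blast
    moreover from this have "0 + e *\<^sub>R v \<in> W"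
      unfolding W using zero_in_entourage_sum[of V, OF V] by (intro set_plus_intro)
    ultimately show ?thesis by auto
  qed
  \<comment> \<open>The \<open>n\<close>-th pieces have to fit into the places \<open>2 n - 1\<close> and \<open>2 n\<close> of the interleaved sum.\<close>
  define V' where "V' n = V (2 * n - 1) \<inter> V (2 * n)" for n
  define \<phi>' where "\<phi>' n x = max (\<phi> (2 * n - 1) x) (\<phi> (2 * n) x)" for n x
  have V': "V' n \<in> universal_uniformity X" if "n \<ge> 1" for n
    unfolding V'_def using that by (intro entourage_Int V) auto
  have \<phi>': "\<phi>' n x > 0" if "n \<ge> 1" "x \<in> topspace X" for n x
    unfolding \<phi>'_def using that \<phi>[of "2 * n" x] by (simp add: less_max_iff_disj)
  have "entourage_sum V' + entourage_sum V' \<subseteq> entourage_sum V"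
    unfolding entourage_sum_eq
    by (intro series_sum_plus_subset entourage_piece_mono zero_in_entourage_piece V')
      (auto simp: V'_def)
  moreover have "weighted_sum X \<phi>' + weighted_sum X \<phi>' \<subseteq> weighted_sum X \<phi>"
    unfolding weighted_sum_eq
    by (intro series_sum_plus_subset weighted_piece_antimono zero_in_weighted_piece \<phi>')
      (auto simp: \<phi>'_def intro: \<phi>)
  ultimately have "(entourage_sum V' + entourage_sum V') + (weighted_sum X \<phi>' + weighted_sum X \<phi>') \<subseteq> W"
    unfolding W by (rule set_plus_mono2)
  then have "(entourage_sum V' + weighted_sum X \<phi>') + (entourage_sum V' + weighted_sum X \<phi>') \<subseteq> W"
    by (simp add: ac_simps)
  then show "\<exists>W'\<in>base_family X. W' + W' \<subseteq> W"
    using base_familyI[of V' X \<phi>', OF V' \<phi>'] by blast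
next
  fix W1 W2 assume "W1 \<in> base_family X" "W2 \<in> base_family X"
  obtain V1 \<phi>1 where W1: "W1 = entourage_sum V1 + weighted_sum X \<phi>1"
    and V1: "\<And>n. n \<ge> 1 \<Longrightarrow> V1 n \<in> universal_uniformity X"
    and \<phi>1: "\<And>n x. n \<ge> 1 \<Longrightarrow> x \<in> topspace X \<Longrightarrow> \<phi>1 n x > 0"
    using base_familyE[OF \<open>W1 \<in> base_family X\<close>] by blast
  obtain V2 \<phi>2 where W2: "W2 = entourage_sum V2 + weighted_sum X \<phi>2"
    and V2: "\<And>n. n \<ge> 1 \<Longrightarrow> V2 n \<in> universal_uniformity X"
    and \<phi>2: "\<And>n x. n \<ge> 1 \<Longrightarrow> x \<in> topspace X \<Longrightarrow> \<phi>2 n x > 0"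
    using base_familyE[OF \<open>W2 \<in> base_family X\<close>] by blast
  define V where "V n = V1 n \<inter> V2 n" for n
  define \<phi> where "\<phi> n x = max (\<phi>1 n x) (\<phi>2 n x)" for n x
  have "entourage_sum V \<subseteq> entourage_sum V1" "entourage_sum V \<subseteq> entourage_sum V2"
    unfolding entourage_sum_eq V_def by (intro series_sum_mono entourage_piece_mono; simp)+
  moreover have "weighted_sum X \<phi> \<subseteq> weighted_sum X \<phi>1" "weighted_sum X \<phi> \<subseteq> weighted_sum X \<phi>2"
    unfolding weighted_sum_eq \<phi>_def
    by (intro series_sum_mono weighted_piece_antimono; simp add: \<phi>1 \<phi>2)+
  ultimately have "entourage_sum V + weighted_sum X \<phi> \<subseteq> W1 \<inter> W2"
    unfolding W1 W2 by (simp add: set_plus_mono2)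
  moreover have "entourage_sum V + weighted_sum X \<phi> \<in> base_family X"
    unfolding V_def \<phi>_def using \<phi>1
    by (intro base_familyI entourage_Int V1 V2) (auto simp: less_max_iff_disj)
  ultimately show "\<exists>W\<in>base_family X. W \<subseteq> W1 \<inter> W2" by blast
qed

section \<open>Comparison with the free topologies\<close>

text \<open>A sum of length one, with coefficient 1: \<open>y - x \<in> W\<close> if \<open>(y, x)\<close> is in the first entourage.\<close>

lemma basis_vec_continuous_at:
  assumes "W \<in> base_family X" "x \<in> topspace X"
  obtains G where "openin X G" "x \<in> G" "\<And>y. y \<in> G \<Longrightarrow> basis_vec y - basis_vec x \<in> W"
proof -
  obtain V \<phi> where W: "W = entourage_sum V + weighted_sum X \<phi>"
    and V: "\<And>n. n \<ge> 1 \<Longrightarrow> V n \<in> universal_uniformity X"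
    and \<phi>: "\<And>n x. n \<ge> 1 \<Longrightarrow> x \<in> topspace X \<Longrightarrow> \<phi> n x > 0"
    using base_familyE[OF assms(1)] by blast
  have "(V 1)\<inverse> \<in> normal_entourages X"
    using entourage_converse[OF V] universal_uniformity_eq[OF creg] by auto
  then obtain G where G: "openin X G" "x \<in> G" "G \<subseteq> (V 1)\<inverse> `` {x}"
    using normal_entourage_neighbourhood assms(2) by metis
  show thesis
  proof
    show "openin X G" "x \<in> G" by fact+
    fix y assume "y \<in> G"
    then have "(y, x) \<in> V 1" using G by auto
    then have "basis_vec y - basis_vec x \<in> entourage_piece (V 1)"
      unfolding entourage_piece_def mem_Collect_eq by (intro exI[of _ 1] exI[of _ y] exI[of _ x]) simp
    then have "basis_vec y - basis_vec x \<in> entourage_sum V"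
      unfolding entourage_sum_eq mem_series_sum
      by (intro exI[of _ "1::nat"] exI[of _ "\<lambda>_. basis_vec y - basis_vec x"]) simp
    then have "basis_vec y - basis_vec x + 0 \<in> W"
      unfolding W using zero_in_weighted_sum[of \<phi>, OF \<phi>] by (intro set_plus_intro) auto
    then show "basis_vec y - basis_vec x \<in> W" by simp
  qed
qed

lemma continuous_basis_vec:
  assumes B: "vector_topology_base (free_vs X) B"
    and finer: "\<And>W. W \<in> B \<Longrightarrow> \<exists>W'\<in>base_family X. W' \<subseteq> W"
  shows "continuous_map X (base_topology (free_vs X) B) basis_vec"
proof -
  interpret vector_topology_base "free_vs X" B by (rule B)
  show ?thesis
    unfolding continuous_map_eq_topcontinuous_at
  proof
    fix x assume x: "x \<in> topspace X"
    have "\<exists>U. openin X U \<and> x \<in> U \<and> (\<forall>y\<in>U. basis_vec y \<in> H)"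
      if H: "openin (base_topology (free_vs X) B) H" "basis_vec x \<in> H" for H
    proof -
      obtain W where W: "W \<in> B" "(+) (basis_vec x) ` W \<subseteq> H"
        using H unfolding openin_base_topology by blast
      obtain W' where W': "W' \<in> base_family X" "W' \<subseteq> W" using finer[OF W(1)] by blast
      obtain G where G: "openin X G" "x \<in> G" "\<And>y. y \<in> G \<Longrightarrow> basis_vec y - basis_vec x \<in> W'"
        using basis_vec_continuous_at[OF W'(1) x] by blast
      have "basis_vec x + (basis_vec y - basis_vec x) \<in> H" if "y \<in> G" for y
        using G(3)[OF that] W' W(2) by blast
      with G show ?thesis by auto
    qed
    then show "topcontinuous_at X (base_topology (free_vs X) B) basis_vec x"
      unfolding topcontinuous_at_def topspace_base_topology
      using x basis_vec_in_free_vs[of _ X] by auto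
  qed
qed

text \<open>The universal property extends the basis embedding to a continuous linear map into the topology
  generated by \<open>B\<close>. This map is the identity, so the free topology is the finer one.
  The lemma is used for \<open>base_family X\<close> itself and for the family of its hulls.\<close>

lemma base_member_zero_neighbourhood:
  assumes T: "free_topology_on_vs P X T"
    and B: "vector_topology_base (free_vs X) B" and P: "P (base_topology (free_vs X) B)"
    and finer: "\<And>W. W \<in> B \<Longrightarrow> \<exists>W'\<in>base_family X. W' \<subseteq> W"
    and W: "W \<in> B"
  shows "zero_neighbourhood T W"
proof -
  interpret vector_topology_base "free_vs X" B by (rule B)
  have top: "topspace T = free_vs X" using T by (simp add: free_topology_on_vs_def)
  obtain g where g: "linear_in (free_vs X) g" "continuous_map T (base_topology (free_vs X) B) g"
    "\<forall>x\<in>topspace X. basis_vec x = g (basis_vec x)"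
    using T P continuous_basis_vec[OF B finer] unfolding free_topology_on_vs_def by metis
  have id: "g v = v" if "v \<in> free_vs X" for v
    using linear_in_free_vs_eq_id[OF g(1) _ that] g(3) by simp
  obtain G where G: "openin (base_topology (free_vs X) B) G" "0 \<in> G" "G \<subseteq> (+) 0 ` W"
    using base_neighbourhood[OF W subspace_0[OF subspace]] by blast
  have "openin T {v \<in> topspace T. g v \<in> G}"
    using g(2) G(1) by (rule openin_continuous_map_preimage)
  moreover have "{v \<in> topspace T. g v \<in> G} = G"
    using id G(1) openin_subset[OF G(1)] unfolding top topspace_base_topology by auto
  ultimately show ?thesis
    unfolding zero_neighbourhood_def top using G base_subset[OF W] by auto
qed

text \<open>The free topological vector space and the free locally convex space both satisfy the hypotheses
  on \<open>T\<close>. The entourages come from a halving sequence for \<open>N\<close>, and \<open>\<phi> n x\<close> is the reciprocal of a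
  factor \<open>e n x\<close> that brings \<open>x\<close> into \<open>M n\<close>.\<close>

lemma base_family_below_zero_neighbourhood:
  assumes T: "tvs T" "topspace T = free_vs X" "continuous_map X T basis_vec"
    and N: "zero_neighbourhood T N"
  shows "\<exists>W\<in>base_family X. W \<subseteq> N"
proof -
  obtain M where M: "M 0 + M 0 \<subseteq> N" "\<And>n. zero_neighbourhood T (M n)" "\<And>n. balanced (M n)"
    "\<And>n. M (Suc n) + M (Suc n) \<subseteq> M n"
    using tvs_halving_sequence[OF T(1) N] by blast
  define V where
    "V n = {(x, y). x \<in> topspace X \<and> y \<in> topspace X \<and> basis_vec x - basis_vec y \<in> M n}" for n
  have V: "V n \<in> universal_uniformity X" for n
    unfolding V_def universal_uniformity_eq[OF creg]
    by (rule tvs_entourage[where M = M, OF T(1,3) M(2-4)])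
  have "\<exists>e>0. e *\<^sub>R basis_vec x \<in> M n" if "x \<in> topspace X" for n x
    using tvs_absorbing[OF T(1) M(2)] T(2) basis_vec_in_free_vs[OF that] by blast
  then have "\<forall>n x. \<exists>e. x \<in> topspace X \<longrightarrow> e > 0 \<and> e *\<^sub>R basis_vec x \<in> M n"
    by blast
  then obtain e where e: "\<And>n x. x \<in> topspace X \<Longrightarrow> e n x > 0"
    "\<And>n x. x \<in> topspace X \<Longrightarrow> e n x *\<^sub>R basis_vec x \<in> M n"
    unfolding choice_iff by blast
  define \<phi> where "\<phi> n x = 1 / e n x" for n x
  have "entourage_sum V \<subseteq> M 0"
    unfolding entourage_sum_eq
  proof (rule series_sum_subset_halving)
    show "entourage_piece (V n) \<subseteq> M n" for n
      unfolding entourage_piece_def V_def using balancedD[OF M(3)] by auto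
    show "0 \<in> M n" for n by (rule zero_neighbourhood_mem[OF M(2)])
  qed (rule M)
  moreover have "weighted_sum X \<phi> \<subseteq> M 0"
    unfolding weighted_sum_eq
  proof (rule series_sum_subset_halving)
    show "weighted_piece (topspace X) (\<phi> n) \<subseteq> M n" for n
      unfolding weighted_piece_def \<phi>_def by (auto intro: balanced_shrink[OF M(3) e(2)] e(1))
    show "0 \<in> M n" for n by (rule zero_neighbourhood_mem[OF M(2)])
  qed (rule M)
  ultimately have "entourage_sum V + weighted_sum X \<phi> \<subseteq> N"
    using M(1) set_plus_mono2 by blast
  moreover have "entourage_sum V + weighted_sum X \<phi> \<in> base_family X"
    using V e(1) by (intro base_familyI) (auto simp: \<phi>_def)
  ultimately show ?thesis by blast
qed

end

theorem theorem2p2: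
  fixes X :: "'a topology" and TV TL :: "('a \<Rightarrow>\<^sub>0 real) topology"
  assumes "completely_regular_space X" and "Hausdorff_space X" and "topspace X \<noteq> {}"
    and "is_free_tvs X TV" and "is_free_lctvs X TL"
  shows "is_neighbourhood_base TV 0 (base_family X) \<and>
         is_neighbourhood_base TL 0 {convex hull W | W. W \<in> base_family X}"
proof
  note X = assms(1,3)
  have baseI: "is_neighbourhood_base T 0 F"
    if "\<And>W. W \<in> F \<Longrightarrow> zero_neighbourhood T W"
      "\<And>G. openin T G \<Longrightarrow> 0 \<in> G \<Longrightarrow> \<exists>W\<in>F. W \<subseteq> G"
    for T :: "('a \<Rightarrow>\<^sub>0 real) topology" and F
    unfolding is_neighbourhood_base_def neighbourhood_base_at_def
    using that unfolding zero_neighbourhood_def by meson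
  have open_nbhd: "zero_neighbourhood T G" if "openin T G" "0 \<in> G"
    for T :: "('a \<Rightarrow>\<^sub>0 real) topology" and G
    using that openin_subset unfolding zero_neighbourhood_def by blast
  let ?C = "{convex hull W | W. W \<in> base_family X}"
  interpret V: vector_topology_base "free_vs X" "base_family X"
    by (rule vector_topology_base_family[OF X])
  interpret L: vector_topology_base "free_vs X" ?C
    by (rule V.vector_topology_base_convex_hull)
  show "is_neighbourhood_base TV 0 (base_family X)"
  proof (rule baseI)
    have TV: "free_topology_on_vs tvs X TV" using assms(4) by (simp add: is_free_tvs_def)
    show "zero_neighbourhood TV W" if "W \<in> base_family X" for W
      by (rule base_member_zero_neighbourhood[OF X TV V.vector_topology_base_axioms
            V.tvs_base_topology _ that]) blast
    show "\<exists>W\<in>base_family X. W \<subseteq> G" if "openin TV G" "0 \<in> G" for G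
      using TV base_family_below_zero_neighbourhood[OF X _ _ _ open_nbhd[OF that]]
      by (simp add: free_topology_on_vs_def)
  qed
  show "is_neighbourhood_base TL 0 ?C"
  proof (rule baseI)
    have TL: "free_topology_on_vs lctvs X TL" using assms(5) by (simp add: is_free_lctvs_def)
    have "lctvs (base_topology (free_vs X) ?C)"
      by (rule L.lctvs_base_topology) (auto intro: convex_convex_hull)
    moreover have "\<exists>W'\<in>base_family X. W' \<subseteq> W" if "W \<in> ?C" for W
      using that hull_subset[of _ convex] by auto
    ultimately show "zero_neighbourhood TL W" if "W \<in> ?C" for W
      by (intro base_member_zero_neighbourhood[OF X TL L.vector_topology_base_axioms _ _ that])
    fix G assume G: "openin TL G" "0 \<in> G"
    have top: "tvs TL" "topspace TL = free_vs X" "continuous_map X TL basis_vec"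
      and "neighbourhood_base_at 0 convex TL"
      using TL unfolding free_topology_on_vs_def lctvs_def by blast+
    then obtain H C where HC: "openin TL H" "convex C" "0 \<in> H" "H \<subseteq> C" "C \<subseteq> G"
      using G unfolding neighbourhood_base_at_def by meson
    obtain W where W: "W \<in> base_family X" "W \<subseteq> H"
      using base_family_below_zero_neighbourhood[OF X top open_nbhd[OF HC(1,3)]] by blast
    have "convex hull W \<subseteq> C"
      using W(2) HC by (intro hull_minimal) auto
    with W(1) HC(5) show "\<exists>W\<in>?C. W \<subseteq> G" by blast
  qed
qed

end
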